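(* Let $K$ be a $\mathcal{CR}(D/\Phi(D))$-module, regarded as a $D$-module via $D\to D/\Phi(D)$. Then $\mathrm{H}^1(D,K)\cong\mathrm{H}^1(D/\Phi(D),K)\oplus\mathrm{F}_p^{\binom d2}$.
   Context: $p$ is an odd prime, $d\ge2$, and $D=\langle y_1,\dots,y_d\rangle$ is a finite $p$-group of exponent $p$ and class $2$ with $|D/\Phi(D)|=p^d$ and $|\Phi(D)/\gamma_3(D)|=p^{\binom d2}$. For a finite $p$-group $L$, an $\mathrm{F}_p(L)$-module $M$ is called a $\mathcal{CR}(L)$-module if $C_M(L)\cong\mathrm{F}_p$ and $\mathrm{H}^1(L,M)$ has order at most $p$. *)

theory Defs
  imports "HOL-Algebra.Algebra" "HOL-Computational_Algebra.Primes"
begin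

definition maximal_subgroup :: "'a set \<Rightarrow> ('a, 'b) monoid_scheme \<Rightarrow> bool" where
  "maximal_subgroup H G \<longleftrightarrow> subgroup H G \<and> H \<noteq> carrier G \<and>
     (\<forall>K. subgroup K G \<and> H \<subseteq> K \<longrightarrow> K = H \<or> K = carrier G)"

text \<open>Frattini subgroup: intersection of all maximal subgroups (the whole group if none).\<close>
definition frattini :: "('a, 'b) monoid_scheme \<Rightarrow> 'a set" where
  "frattini G = carrier G \<inter> \<Inter> {H. maximal_subgroup H G}"

definition commutator_subgroup :: "('a, 'b) monoid_scheme \<Rightarrow> 'a set \<Rightarrow> 'a set \<Rightarrow> 'a set" where
  "commutator_subgroup G A B = generate G
     {a \<otimes>\<^bsub>G\<^esub> b \<otimes>\<^bsub>G\<^esub> inv\<^bsub>G\<^esub> a \<otimes>\<^bsub>G\<^esub> inv\<^bsub>G\<^esub> b | a b. a \<in> A \<and> b \<in> B}"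

fun lower_central :: "('a, 'b) monoid_scheme \<Rightarrow> nat \<Rightarrow> 'a set" where
  "lower_central G 0 = carrier G"
| "lower_central G (Suc 0) = carrier G"
| "lower_central G (Suc (Suc n)) = commutator_subgroup G (lower_central G (Suc n)) (carrier G)"

text \<open>An F_p(L)-module: an elementary abelian p-group M (written multiplicatively,
  hence an F_p-vector space) with a left action of L by group automorphisms.\<close>
definition Fp_module ::
  "nat \<Rightarrow> ('g, 'c) monoid_scheme \<Rightarrow> ('m, 'e) monoid_scheme \<Rightarrow> ('g \<Rightarrow> 'm \<Rightarrow> 'm) \<Rightarrow> bool" where
  "Fp_module p L M act \<longleftrightarrow> group L \<and> comm_group M \<and>
     (\<forall>x\<in>carrier M. x [^]\<^bsub>M\<^esub> p = \<one>\<^bsub>M\<^esub>) \<and>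
     (\<forall>g\<in>carrier L. act g \<in> hom M M) \<and>
     (\<forall>m\<in>carrier M. act \<one>\<^bsub>L\<^esub> m = m) \<and>
     (\<forall>g\<in>carrier L. \<forall>h\<in>carrier L. \<forall>m\<in>carrier M. act (g \<otimes>\<^bsub>L\<^esub> h) m = act g (act h m))"

definition fixed_points ::
  "('g, 'c) monoid_scheme \<Rightarrow> ('m, 'e) monoid_scheme \<Rightarrow> ('g \<Rightarrow> 'm \<Rightarrow> 'm) \<Rightarrow> 'm set" where
  "fixed_points L M act = {m \<in> carrier M. \<forall>g\<in>carrier L. act g m = m}"

definition crossed_homs ::
  "('g, 'c) monoid_scheme \<Rightarrow> ('m, 'e) monoid_scheme \<Rightarrow> ('g \<Rightarrow> 'm \<Rightarrow> 'm) \<Rightarrow> ('g \<Rightarrow> 'm) set" where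
  "crossed_homs L M act = {f \<in> carrier L \<rightarrow>\<^sub>E carrier M.
     \<forall>g\<in>carrier L. \<forall>h\<in>carrier L. f (g \<otimes>\<^bsub>L\<^esub> h) = f g \<otimes>\<^bsub>M\<^esub> act g (f h)}"

definition principal_crossed_homs ::
  "('g, 'c) monoid_scheme \<Rightarrow> ('m, 'e) monoid_scheme \<Rightarrow> ('g \<Rightarrow> 'm \<Rightarrow> 'm) \<Rightarrow> ('g \<Rightarrow> 'm) set" where
  "principal_crossed_homs L M act =
     (\<lambda>m. \<lambda>g\<in>carrier L. act g m \<otimes>\<^bsub>M\<^esub> inv\<^bsub>M\<^esub> m) ` carrier M"

definition Z1_group ::
  "('g, 'c) monoid_scheme \<Rightarrow> ('m, 'e) monoid_scheme \<Rightarrow> ('g \<Rightarrow> 'm \<Rightarrow> 'm) \<Rightarrow> ('g \<Rightarrow> 'm) monoid" where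
  "Z1_group L M act = \<lparr>carrier = crossed_homs L M act,
     monoid.mult = (\<lambda>f f'. \<lambda>g\<in>carrier L. f g \<otimes>\<^bsub>M\<^esub> f' g),
     one = (\<lambda>g\<in>carrier L. \<one>\<^bsub>M\<^esub>)\<rparr>"

definition H1 ::
  "('g, 'c) monoid_scheme \<Rightarrow> ('m, 'e) monoid_scheme \<Rightarrow> ('g \<Rightarrow> 'm \<Rightarrow> 'm) \<Rightarrow> ('g \<Rightarrow> 'm) set monoid" where
  "H1 L M act = Z1_group L M act Mod principal_crossed_homs L M act"

definition CR_module ::
  "nat \<Rightarrow> ('g, 'c) monoid_scheme \<Rightarrow> ('m, 'e) monoid_scheme \<Rightarrow> ('g \<Rightarrow> 'm \<Rightarrow> 'm) \<Rightarrow> bool" where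
  "CR_module p L M act \<longleftrightarrow> Fp_module p L M act \<and>
     (M\<lparr>carrier := fixed_points L M act\<rparr>) \<cong> integer_mod_group p \<and>
     finite (carrier (H1 L M act)) \<and> card (carrier (H1 L M act)) \<le> p"

definition Fp_power :: "nat \<Rightarrow> nat \<Rightarrow> (nat \<Rightarrow> int) monoid" where
  "Fp_power p n = product_group {..<n} (\<lambda>_. integer_mod_group p)"

end

(*
  Let N = Phi(D). Class two makes N = gamma_2(D) central, so restriction maps H^1(D, K) to
  Hom(N, C_K(D)), which is F_p^(d choose 2), and its kernel is H^1(D/N, K). Everything is
  elementary abelian, so it remains to extend each homomorphism phi : N -> C_K(D) = <z> to a
  crossed homomorphism f on D.

  Since p is odd, x o y = x y [y,x]^(1/2) makes D elementary abelian (Baer), hence phi extends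
  to (D, o); viewed on D itself the extension fails to be additive by the alternating form
  b(g,h) = phi([h,g]) / 2. The form must become a coboundary with values in K. A linear form k
  on D/N satisfies k(g) z = g m - m for some m in K exactly if its class in H^1(D/N, K) vanishes,
  and as that group has order at most p, these k form a subspace W of codimension at most 1.
  Modulo the coboundary of a quadratic form q, the form -b is a bilinear form beta with all
  beta(.,h) in W. Solving g m_h = m_h + beta(g,h) z additively in h, and compatibly with phi,
  gives psi : (D, o) -> K, and f = psi + q z is the required extension.
*)
theory Submission
  imports Defs "HOL-Number_Theory.Cong"
begin

subsection \<open>Elementary abelian groups\<close>

text \<open>Let V be the space of linear forms on D/N. The obstruction to extending phi is its
  transgression in H^2(D/N, K), represented up to sign by the alternating form b with values in the
  multiples of z. Symmetric forms are coboundaries of quadratic forms since 2 is invertible, and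
  forms all of whose slices beta(.,h) lie in W can be absorbed in K. Dividing V tensor V by both
  kinds leaves the exterior square of V/W. It vanishes once V/W has dimension at most 1, and this is
  where the bound on the order of H^1 is spent: two independent classes mu, nu would leave mu wedge
  nu. Absorbing a form means choosing m_h additively in h while the values on N are prescribed. This
  is a lifting problem between elementary abelian groups, solvable one generator at a time. Linear
  forms are kept as integer functions read modulo p, so that their values can serve directly as
  exponents of z.\<close>

lemma (in group) int_pow_exponent_cong:
  assumes "x \<in> carrier G" "x [^] p = \<one>" "[k = l] (mod int p)"
  shows "x [^] k = x [^] l"
proof -
  obtain t where "k = l + int p * t"
    using assms(3) by (metis cong_iff_lin cong_sym)
  then show ?thesis
    using assms(1,2) by (simp add: int_pow_mult int_pow_int flip: int_pow_pow)
qed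

text \<open>If p does not divide k, then k is invertible modulo p and x itself is a power of x^k.
  This is what makes the exponent of a newly adjoined element unique modulo p.\<close>

lemma (in group) int_pow_mem_subgroup_imp_dvd:
  assumes p: "Factorial_Ring.prime p" and x: "x \<in> carrier G" "x [^] p = \<one>"
    and H: "subgroup H G" "x \<notin> H" "x [^] (k::int) \<in> H"
  shows "int p dvd k"
proof (rule ccontr)
  assume "\<not> int p dvd k"
  then have "coprime k (int p)"
    using p by (metis coprime_commute prime_imp_coprime prime_nat_int_transfer)
  then obtain t where "[k * t = 1] (mod int p)"
    using cong_solve_coprime_int by blast
  then have "x [^] (k * t) = x"
    using int_pow_exponent_cong[OF x] x by (metis int_pow_1)
  moreover have "(x [^] k) [^] t \<in> H"
    using H subgroup_int_pow_closed by blast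
  ultimately show False
    using H x by (simp add: int_pow_pow)
qed

text \<open>A total multiplicative relation between elementary abelian groups contains the graph of
  a homomorphism, even with prescribed values on \<open>B\<close>: adjoin one element
  \<open>a\<close> at a time and send it to any partner \<open>e\<close>; the order of
  \<open>e\<close> divides p, so no relation is violated. It is used twice: to solve the equations
  for \<open>\<psi>\<close> inside K, and to split the restriction map to N.\<close>

lemma hom_extension_within_relation:
  fixes p :: nat and A :: "('a, 'c) monoid_scheme" and E :: "('e, 'f) monoid_scheme"
  assumes p: "Factorial_Ring.prime p"
    and A: "comm_group A" "finite (carrier A)" "\<And>x. x \<in> carrier A \<Longrightarrow> x [^]\<^bsub>A\<^esub> p = \<one>\<^bsub>A\<^esub>"
    and E: "comm_group E" "\<And>x. x \<in> carrier E \<Longrightarrow> x [^]\<^bsub>E\<^esub> p = \<one>\<^bsub>E\<^esub>"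
    and R_total: "\<And>a. a \<in> carrier A \<Longrightarrow> \<exists>e \<in> carrier E. R a e"
    and R_mult: "\<And>a b e f. \<lbrakk>a \<in> carrier A; b \<in> carrier A; e \<in> carrier E; f \<in> carrier E; R a e; R b f\<rbrakk>
                   \<Longrightarrow> R (a \<otimes>\<^bsub>A\<^esub> b) (e \<otimes>\<^bsub>E\<^esub> f)"
    and B: "subgroup B A"
    and phi: "\<And>b. b \<in> B \<Longrightarrow> \<phi> b \<in> carrier E" "\<And>b. b \<in> B \<Longrightarrow> R b (\<phi> b)"
      "\<And>b c. b \<in> B \<Longrightarrow> c \<in> B \<Longrightarrow> \<phi> (b \<otimes>\<^bsub>A\<^esub> c) = \<phi> b \<otimes>\<^bsub>E\<^esub> \<phi> c"
  shows "\<exists>\<psi> \<in> hom A E. (\<forall>b\<in>B. \<psi> b = \<phi> b) \<and> (\<forall>a\<in>carrier A. R a (\<psi> a))"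
  using B phi
proof (induction "card (carrier A - B)" arbitrary: B \<phi> rule: less_induct)
  case less
  interpret A: comm_group A by fact
  interpret E: comm_group E by fact
  interpret B: subgroup B A by fact
  show ?case
  proof (cases "B = carrier A")
    case True
    then have "\<phi> \<in> hom A E"
      using less.prems by (auto simp: hom_def)
    then show ?thesis
      using True less.prems by blast
  next
    case False
    then obtain a where a: "a \<in> carrier A" "a \<notin> B"
      using B.subset by blast
    obtain e where e: "e \<in> carrier E" "R a e"
      using R_total a by blast
    \<comment> \<open>Natural exponents match \<open>R\<close>, which is only known to be closed
      under products; as a^p = 1 they still give a subgroup.\<close>
    define B' where "B' = {b \<otimes>\<^bsub>A\<^esub> a [^]\<^bsub>A\<^esub> k | b (k::nat). b \<in> B}"
    have B'I: "b \<otimes>\<^bsub>A\<^esub> a [^]\<^bsub>A\<^esub> k \<in> B'" if "b \<in> B" for b and k :: nat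
      using that by (auto simp: B'_def)
    have R_pow: "R (b \<otimes>\<^bsub>A\<^esub> a [^]\<^bsub>A\<^esub> k) (\<phi> b \<otimes>\<^bsub>E\<^esub> e [^]\<^bsub>E\<^esub> k)" if "b \<in> B" for b and k :: nat
    proof (induction k)
      case 0
      then show ?case using less.prems that by simp
    next
      case (Suc k)
      then have "R ((b \<otimes>\<^bsub>A\<^esub> a [^]\<^bsub>A\<^esub> k) \<otimes>\<^bsub>A\<^esub> a) ((\<phi> b \<otimes>\<^bsub>E\<^esub> e [^]\<^bsub>E\<^esub> k) \<otimes>\<^bsub>E\<^esub> e)"
        using R_mult[OF _ a(1) _ e(1) Suc e(2)] that a e less.prems by auto
      then show ?case
        using that a e less.prems by (simp add: A.m_assoc E.m_assoc)
    qed
    \<comment> \<open>Since \<open>a\<close> lies outside \<open>B\<close>, an element of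
      \<open>B'\<close> determines its factor in \<open>B\<close> and the exponent modulo p, and
      \<open>e\<close> does not see multiples of p.\<close>
    have wd: "b = c \<and> e [^]\<^bsub>E\<^esub> k = e [^]\<^bsub>E\<^esub> l"
      if bc: "b \<in> B" "c \<in> B" and eq: "b \<otimes>\<^bsub>A\<^esub> a [^]\<^bsub>A\<^esub> k = c \<otimes>\<^bsub>A\<^esub> a [^]\<^bsub>A\<^esub> l" for b c and k l :: nat
    proof -
      have "c = (b \<otimes>\<^bsub>A\<^esub> a [^]\<^bsub>A\<^esub> k) \<otimes>\<^bsub>A\<^esub> inv\<^bsub>A\<^esub> (a [^]\<^bsub>A\<^esub> l)"
        unfolding eq using a bc by (simp add: A.m_assoc)
      then have "a [^]\<^bsub>A\<^esub> (int k - int l) = inv\<^bsub>A\<^esub> b \<otimes>\<^bsub>A\<^esub> c"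
        using a bc by (simp add: A.int_pow_diff int_pow_int A.m_assoc A.inv_solve_left)
      then have dvd: "int p dvd int k - int l"
        using A.int_pow_mem_subgroup_imp_dvd[OF p a(1) A(3)[OF a(1)] less.prems(1) a(2)] bc by auto
      then have cong: "[int k = int l] (mod int p)"
        by (simp add: cong_iff_dvd_diff)
      have "a [^]\<^bsub>A\<^esub> k = a [^]\<^bsub>A\<^esub> l" "e [^]\<^bsub>E\<^esub> k = e [^]\<^bsub>E\<^esub> l"
        using A.int_pow_exponent_cong[OF a(1) A(3)[OF a(1)] cong]
          E.int_pow_exponent_cong[OF e(1) E(2)[OF e(1)] cong] by (simp_all add: int_pow_int)
      then show ?thesis
        using eq a bc by auto
    qed
    define \<phi>' where "\<phi>' x = (SOME y. \<exists>b (k::nat). b \<in> B \<and> x = b \<otimes>\<^bsub>A\<^esub> a [^]\<^bsub>A\<^esub> k \<and> y = \<phi> b \<otimes>\<^bsub>E\<^esub> e [^]\<^bsub>E\<^esub> k)" for x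
    have \<phi>': "\<phi>' (b \<otimes>\<^bsub>A\<^esub> a [^]\<^bsub>A\<^esub> k) = \<phi> b \<otimes>\<^bsub>E\<^esub> e [^]\<^bsub>E\<^esub> k" if "b \<in> B" for b and k :: nat
      unfolding \<phi>'_def
    proof (rule some_equality)
      show "\<exists>b' k'. b' \<in> B \<and> b \<otimes>\<^bsub>A\<^esub> a [^]\<^bsub>A\<^esub> k = b' \<otimes>\<^bsub>A\<^esub> a [^]\<^bsub>A\<^esub> k' \<and> \<phi> b \<otimes>\<^bsub>E\<^esub> e [^]\<^bsub>E\<^esub> k = \<phi> b' \<otimes>\<^bsub>E\<^esub> e [^]\<^bsub>E\<^esub> (k'::nat)"
        using that by blast
    qed (use wd that in metis)
    have prod: "(b \<otimes>\<^bsub>A\<^esub> a [^]\<^bsub>A\<^esub> k) \<otimes>\<^bsub>A\<^esub> (c \<otimes>\<^bsub>A\<^esub> a [^]\<^bsub>A\<^esub> l) = (b \<otimes>\<^bsub>A\<^esub> c) \<otimes>\<^bsub>A\<^esub> a [^]\<^bsub>A\<^esub> (k + l)"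
      if "b \<in> B" "c \<in> B" for b c and k l :: nat
      using that a by (simp add: A.m_ac flip: A.nat_pow_mult)
    have sub: "subgroup B' A"
    proof (rule A.subgroupI)
      show "B' \<subseteq> carrier A" using a by (auto simp: B'_def)
      show "B' \<noteq> {}" using B'I[OF B.one_closed] by blast
      show "inv\<^bsub>A\<^esub> x \<in> B'" if "x \<in> B'" for x
      proof -
        obtain b and k :: nat where x: "b \<in> B" "x = b \<otimes>\<^bsub>A\<^esub> a [^]\<^bsub>A\<^esub> k"
          using \<open>x \<in> B'\<close> by (auto simp: B'_def)
        \<comment> \<open>The inverse of a^k is the natural power a^(pk - k).\<close>
        have "k \<le> p * k"
          using prime_gt_0_nat[OF p] by simp
        then obtain t where t: "k + t = p * k"
          using le_Suc_ex by metis
        have "inv\<^bsub>A\<^esub> (a [^]\<^bsub>A\<^esub> k) = a [^]\<^bsub>A\<^esub> t"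
          using a A(3)[OF a(1)] t
          by (intro A.inv_equality) (simp_all add: A.nat_pow_mult add.commute[of t] flip: A.nat_pow_pow)
        then have "inv\<^bsub>A\<^esub> x = inv\<^bsub>A\<^esub> b \<otimes>\<^bsub>A\<^esub> a [^]\<^bsub>A\<^esub> t"
          using x a by (simp add: A.inv_mult)
        then show ?thesis
          using B'I x by simp
      qed
      show "x \<otimes>\<^bsub>A\<^esub> y \<in> B'" if "x \<in> B'" "y \<in> B'" for x y
        proof -
        obtain b c and k l :: nat where *: "b \<in> B" "c \<in> B" "x = b \<otimes>\<^bsub>A\<^esub> a [^]\<^bsub>A\<^esub> k" "y = c \<otimes>\<^bsub>A\<^esub> a [^]\<^bsub>A\<^esub> l"
          using \<open>x \<in> B'\<close> \<open>y \<in> B'\<close> by (auto simp: B'_def)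
        show ?thesis
          unfolding *(3,4) prod[OF *(1,2)] using B'I *(1,2) by simp
      qed
    qed
    have "B \<subseteq> B'"
    proof
      fix b assume "b \<in> B"
      then show "b \<in> B'" using B'I[of b 0] by simp
    qed
    moreover have "a \<in> B'"
      using B'I[OF B.one_closed, of 1] a by simp
    ultimately have BB': "B \<subseteq> B'" "a \<in> B'" .
    have smaller: "card (carrier A - B') < card (carrier A - B)"
      using BB' a A(2) by (intro psubset_card_mono) auto
    have "\<exists>\<psi>\<in>hom A E. (\<forall>b\<in>B'. \<psi> b = \<phi>' b) \<and> (\<forall>a\<in>carrier A. R a (\<psi> a))"
    proof (rule less.hyps[OF smaller sub])
      show "\<phi>' x \<in> carrier E" if "x \<in> B'" for x
        using that \<phi>' less.prems e by (auto simp: B'_def)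
      show "R x (\<phi>' x)" if "x \<in> B'" for x
        using that \<phi>' R_pow by (auto simp: B'_def)
      show "\<phi>' (x \<otimes>\<^bsub>A\<^esub> y) = \<phi>' x \<otimes>\<^bsub>E\<^esub> \<phi>' y" if "x \<in> B'" "y \<in> B'" for x y
      proof -
        obtain b c and k l :: nat where *: "b \<in> B" "c \<in> B" "x = b \<otimes>\<^bsub>A\<^esub> a [^]\<^bsub>A\<^esub> k" "y = c \<otimes>\<^bsub>A\<^esub> a [^]\<^bsub>A\<^esub> l"
          using \<open>x \<in> B'\<close> \<open>y \<in> B'\<close> by (auto simp: B'_def)
        have "\<phi>' (x \<otimes>\<^bsub>A\<^esub> y) = \<phi> (b \<otimes>\<^bsub>A\<^esub> c) \<otimes>\<^bsub>E\<^esub> e [^]\<^bsub>E\<^esub> (k + l)"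
          unfolding * prod[OF *(1,2)] by (rule \<phi>') (use * in auto)
        also have "\<dots> = \<phi>' x \<otimes>\<^bsub>E\<^esub> \<phi>' y"
          using * e less.prems by (simp add: \<phi>' E.m_ac flip: E.nat_pow_mult)
        finally show ?thesis .
      qed
    qed
    then obtain \<psi> where psi: "\<psi> \<in> hom A E" "\<forall>b\<in>B'. \<psi> b = \<phi>' b" "\<forall>a\<in>carrier A. R a (\<psi> a)"
      by blast
    have "\<forall>b\<in>B. \<psi> b = \<phi> b"
    proof
      fix b assume "b \<in> B"
      then show "\<psi> b = \<phi> b"
        using psi(2) BB' \<phi>'[of b 0] less.prems by (simp add: subset_iff)
    qed
    then show ?thesis
      using psi by blast
  qed
qed

section \<open>Coordinates: the model F_p^n of an elementary abelian group\<close>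

lemma comm_group_Fp_power: "comm_group (Fp_power p n)"
  unfolding Fp_power_def
  by (rule group.group_comm_groupI) (auto simp: add.commute intro: restrict_ext)

lemma carrier_Fp_power:
  "p > 0 \<Longrightarrow> carrier (Fp_power p n) = (\<Pi>\<^sub>E i\<in>{..<n}. {0..<int p})"
  by (simp add: Fp_power_def carrier_integer_mod_group)

lemma mult_Fp_power:
  "v \<otimes>\<^bsub>Fp_power p n\<^esub> w = (\<lambda>i\<in>{..<n}. (v i + w i) mod int p)"
  by (simp add: Fp_power_def)

lemma one_Fp_power: "\<one>\<^bsub>Fp_power p n\<^esub> = (\<lambda>i\<in>{..<n}. 0)"
  by (simp add: Fp_power_def)

lemma finite_Fp_power: "p > 0 \<Longrightarrow> finite (carrier (Fp_power p n))"
  by (simp add: carrier_Fp_power finite_PiE)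

lemma order_Fp_power: "p > 0 \<Longrightarrow> order (Fp_power p n) = p ^ n"
  by (simp add: order_def carrier_Fp_power card_PiE)

lemma nat_pow_Fp_power:
  "v [^]\<^bsub>Fp_power p n\<^esub> (k::nat) = (\<lambda>i\<in>{..<n}. (int k * v i) mod int p)"
  by (induction k) (auto simp: mult_Fp_power one_Fp_power nat_pow_def mod_simps algebra_simps)

lemma Fp_power_exponent:
  "v [^]\<^bsub>Fp_power p n\<^esub> p = \<one>\<^bsub>Fp_power p n\<^esub>"
  by (auto simp: nat_pow_Fp_power one_Fp_power)

text \<open>Growing an embedding by cardinality avoids choosing a basis: the image of F_p^k has p^k
  < |A| elements, so some \<open>a\<close> lies outside it and becomes the image of the next unit
  vector.\<close>

lemma Fp_power_embedding:
  fixes A :: "('a, 'c) monoid_scheme"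
  assumes p: "Factorial_Ring.prime p"
    and A: "comm_group A" "finite (carrier A)" "\<And>x. x \<in> carrier A \<Longrightarrow> x [^]\<^bsub>A\<^esub> p = \<one>\<^bsub>A\<^esub>"
    and le: "p ^ k \<le> order A"
  shows "\<exists>\<iota> \<in> hom (Fp_power p k) A. inj_on \<iota> (carrier (Fp_power p k))"
  using le
proof (induction k)
  case 0
  interpret A: comm_group A by fact
  show ?case
    by (rule bexI[of _ "\<lambda>_. \<one>\<^bsub>A\<^esub>"]) (auto simp: hom_def inj_on_def Fp_power_def)
next
  case (Suc k)
  interpret A: comm_group A by fact
  interpret F: comm_group "Fp_power p k" by (rule comm_group_Fp_power)
  interpret F': comm_group "Fp_power p (Suc k)" by (rule comm_group_Fp_power)
  have p0: "p > 0" "p > 1" using p prime_gt_0_nat prime_gt_1_nat by auto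
  have lt: "p ^ k < order A"
    using Suc.prems p0 by (metis le_less_trans linorder_not_less power_strict_increasing lessI less_le_trans)
  then obtain \<iota> where iota: "\<iota> \<in> hom (Fp_power p k) A" "inj_on \<iota> (carrier (Fp_power p k))"
    using Suc.IH by auto
  interpret \<iota>: group_hom "Fp_power p k" A \<iota>
    using iota by unfold_locales
  define H where "H = \<iota> ` carrier (Fp_power p k)"
  have H: "subgroup H A"
    unfolding H_def by (rule \<iota>.img_is_subgroup)
  have "card H = p ^ k"
    using order_Fp_power[OF p0(1), of k] iota by (simp add: H_def card_image order_def)
  then have "H \<noteq> carrier A"
    using lt by (auto simp: order_def)
  then obtain a where a: "a \<in> carrier A" "a \<notin> H"
    using subgroup.subset[OF H] by auto
  \<comment> \<open>\<open>r\<close> forgets the last coordinate, and \<open>j\<close> uses that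
    coordinate as the exponent of \<open>a\<close>.\<close>
  define r where "r v = restrict v {..<k}" for v :: "nat \<Rightarrow> int"
  define j where "j v = \<iota> (r v) \<otimes>\<^bsub>A\<^esub> a [^]\<^bsub>A\<^esub> (v k)" for v
  have r: "r v \<in> carrier (Fp_power p k)" if "v \<in> carrier (Fp_power p (Suc k))" for v
    using that p0 unfolding carrier_Fp_power[OF p0(1)] r_def
    by (auto simp: PiE_iff)
  have rm: "r (v \<otimes>\<^bsub>Fp_power p (Suc k)\<^esub> w) = r v \<otimes>\<^bsub>Fp_power p k\<^esub> r w" for v w
    unfolding mult_Fp_power r_def by (auto simp: fun_eq_iff)
  have "j \<in> hom (Fp_power p (Suc k)) A"
  proof (rule homI)
    fix v w assume vw: "v \<in> carrier (Fp_power p (Suc k))" "w \<in> carrier (Fp_power p (Suc k))"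
    show "j v \<in> carrier A"
      using vw r a by (simp add: j_def)
    have "a [^]\<^bsub>A\<^esub> ((v k + w k) mod int p) = a [^]\<^bsub>A\<^esub> (v k + w k)"
      using a A(3) by (intro A.int_pow_exponent_cong) (auto simp: cong_def)
    then have "a [^]\<^bsub>A\<^esub> ((v \<otimes>\<^bsub>Fp_power p (Suc k)\<^esub> w) k) = a [^]\<^bsub>A\<^esub> v k \<otimes>\<^bsub>A\<^esub> a [^]\<^bsub>A\<^esub> w k"
      using a by (simp add: mult_Fp_power A.int_pow_mult)
    then show "j (v \<otimes>\<^bsub>Fp_power p (Suc k)\<^esub> w) = j v \<otimes>\<^bsub>A\<^esub> j w"
      using vw r a unfolding j_def rm by (simp add: A.m_ac)
  qed
  then interpret j: group_hom "Fp_power p (Suc k)" A j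
    by unfold_locales
  have "inj_on j (carrier (Fp_power p (Suc k)))"
  proof (subst j.inj_on_one_iff, safe)
    fix v assume v: "v \<in> carrier (Fp_power p (Suc k))" and jv: "j v = \<one>\<^bsub>A\<^esub>"
    have "\<iota> (r v) \<in> H" using r v by (auto simp: H_def)
    moreover have "a [^]\<^bsub>A\<^esub> (v k) = inv\<^bsub>A\<^esub> (\<iota> (r v))"
      using jv r v a unfolding j_def by (metis A.int_pow_closed A.inv_comm A.inv_equality \<iota>.hom_closed)
    ultimately have "a [^]\<^bsub>A\<^esub> (v k) \<in> H"
      using H by (simp add: subgroup.m_inv_closed)
    then have "int p dvd v k"
      using A.int_pow_mem_subgroup_imp_dvd[OF p a(1) A(3)[OF a(1)] H a(2)] by blast
    moreover have "0 \<le> v k" "v k < int p"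
      using v by (auto simp: carrier_Fp_power[OF p0(1)] PiE_iff)
    ultimately have vk: "v k = 0"
      using zdvd_imp_le[of "int p" "v k"] by linarith
    then have "r v = \<one>\<^bsub>Fp_power p k\<^esub>"
      using jv r[OF v] iota(2) unfolding j_def by (simp add: \<iota>.inj_on_one_iff)
    then have "v i = 0" if "i < Suc k" for i
      using vk that by (auto simp: r_def one_Fp_power less_Suc_eq fun_eq_iff split: if_splits)
    then show "v = \<one>\<^bsub>Fp_power p (Suc k)\<^esub>"
      using v by (auto simp: carrier_Fp_power[OF p0(1)] one_Fp_power fun_eq_iff PiE_iff extensional_def)
  qed
  then show ?case
    using j.homh by blast
qed

lemma elementary_abelian_iso_Fp_power:
  fixes A :: "('a, 'c) monoid_scheme"
  assumes p: "Factorial_Ring.prime p"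
    and A: "comm_group A" "\<And>x. x \<in> carrier A \<Longrightarrow> x [^]\<^bsub>A\<^esub> p = \<one>\<^bsub>A\<^esub>"
    and ord: "order A = p ^ n"
  shows "\<exists>\<iota>. \<iota> \<in> iso (Fp_power p n) A"
proof -
  have p0: "p > 0" using p prime_gt_0_nat by auto
  have fin: "finite (carrier A)"
    using ord p0 by (metis card.infinite order_def power_eq_0_iff less_irrefl)
  obtain \<iota> where iota: "\<iota> \<in> hom (Fp_power p n) A" "inj_on \<iota> (carrier (Fp_power p n))"
    using Fp_power_embedding[OF p A(1) fin A(2)] ord by fastforce
  have "\<iota> ` carrier (Fp_power p n) = carrier A"
  proof (rule card_subset_eq[OF fin])
    show "\<iota> ` carrier (Fp_power p n) \<subseteq> carrier A"
      using iota by (auto simp: hom_def)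
    show "card (\<iota> ` carrier (Fp_power p n)) = card (carrier A)"
      using iota ord order_Fp_power[OF p0, of n] by (simp add: card_image order_def)
  qed
  then show ?thesis
    using iota by (auto simp: iso_def bij_betw_def)
qed

text \<open>The unit vectors generate: v is built up by its truncations to the first m coordinates,
  each new one adding a multiple of a unit vector. This will show that a crossed homomorphism
  vanishing on a basis of N vanishes on N.\<close>

lemma hom_Fp_power_eq_oneI:
  assumes p: "p > 1" and G: "group G" and f: "f \<in> hom (Fp_power p n) G"
    and unit: "\<And>i. i < n \<Longrightarrow> f (\<lambda>j\<in>{..<n}. if j = i then 1 else 0) = \<one>\<^bsub>G\<^esub>"
    and v: "v \<in> carrier (Fp_power p n)"
  shows "f v = \<one>\<^bsub>G\<^esub>"
proof -
  interpret G: group G by fact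
  interpret F: comm_group "Fp_power p n" by (rule comm_group_Fp_power)
  interpret f: group_hom "Fp_power p n" G f
    using f by unfold_locales
  have p0: "p > 0" using p by simp
  have "f (\<lambda>j\<in>{..<n}. if j < m then v j else 0) = \<one>\<^bsub>G\<^esub>" if "m \<le> n" for m
    using that
  proof (induction m)
    case 0
    have "(\<lambda>j\<in>{..<n}. if j < 0 then v j else 0) = \<one>\<^bsub>Fp_power p n\<^esub>"
      by (simp add: one_Fp_power)
    then show ?case
      using f.hom_one by (simp only:)
  next
    case (Suc m)
    let ?u = "\<lambda>j\<in>{..<n}. if j < m then v j else 0" and ?e = "\<lambda>j\<in>{..<n}. if j = m then 1 else 0 :: int"
    have vb: "0 \<le> v i" "v i < int p" if "i < n" for i
      using v that by (auto simp: carrier_Fp_power[OF p0] PiE_iff)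
    have car: "?u \<in> carrier (Fp_power p n)" "?e \<in> carrier (Fp_power p n)"
      using vb p by (auto simp: carrier_Fp_power[OF p0])
    have "(\<lambda>j\<in>{..<n}. if j < Suc m then v j else 0) = ?u \<otimes>\<^bsub>Fp_power p n\<^esub> ?e [^]\<^bsub>Fp_power p n\<^esub> nat (v m)"
    proof (rule ext)
      fix x
      consider "\<not> x < n" | "x < n" "x < m" | "x < n" "x = m" | "x < n" "m < x"
        by linarith
      then show "(\<lambda>j\<in>{..<n}. if j < Suc m then v j else 0) x = (?u \<otimes>\<^bsub>Fp_power p n\<^esub> ?e [^]\<^bsub>Fp_power p n\<^esub> nat (v m)) x"
        by cases (use vb[of x] in \<open>simp_all add: mult_Fp_power nat_pow_Fp_power\<close>)
    qed
    moreover have "f (?u \<otimes>\<^bsub>Fp_power p n\<^esub> ?e [^]\<^bsub>Fp_power p n\<^esub> nat (v m)) = f ?u \<otimes>\<^bsub>G\<^esub> f ?e [^]\<^bsub>G\<^esub> nat (v m)"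
      using f.hom_mult[OF car(1) F.nat_pow_closed[OF car(2)]] f.hom_nat_pow[OF car(2)] by (simp only:)
    moreover have "f ?u = \<one>\<^bsub>G\<^esub>"
      by (rule Suc.IH[OF Suc_leD[OF Suc.prems]])
    moreover have "f ?e = \<one>\<^bsub>G\<^esub>"
      by (rule unit) (use Suc.prems in simp)
    ultimately show ?case
      by (simp only: G.nat_pow_one G.l_one G.one_closed)
  qed
  from this[of n] show ?thesis
    using v by (simp add: carrier_Fp_power[OF p0] PiE_iff extensional_restrict cong: restrict_cong)
qed

subsection \<open>Groups of class two and odd prime exponent\<close>

text \<open>\<open>N\<close> is the derived subgroup, given by its generators so that induction over
  commutators is available; \<open>central\<close> says that the class is at most two. That
  \<open>N\<close> is also the Frattini subgroup is shown later.\<close>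

locale class_two_group = group D for D (structure) +
  fixes N :: "'a set" and p :: nat
  assumes p: "Factorial_Ring.prime p" "odd p"
    and fin: "finite (carrier D)"
    and exponent: "x \<in> carrier D \<Longrightarrow> x [^] p = \<one>"
    and N_def: "N = generate D {x \<otimes> y \<otimes> inv x \<otimes> inv y | x y. x \<in> carrier D \<and> y \<in> carrier D}"
    and central: "\<lbrakk>n \<in> N; x \<in> carrier D\<rbrakk> \<Longrightarrow> n \<otimes> x = x \<otimes> n"
begin

definition com :: "'a \<Rightarrow> 'a \<Rightarrow> 'a" where
  "com x y = x \<otimes> y \<otimes> inv x \<otimes> inv y"

lemma N_subgroup: "subgroup N D"
  unfolding N_def by (rule generate_is_subgroup) auto

lemma N_closed [simp]: "n \<in> N \<Longrightarrow> n \<in> carrier D"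
  using subgroup.subset[OF N_subgroup] by auto

lemma com_in_N [simp]: "\<lbrakk>x \<in> carrier D; y \<in> carrier D\<rbrakk> \<Longrightarrow> com x y \<in> N"
  unfolding N_def com_def by (auto intro: generate.incl)

lemma com_closed [simp]: "\<lbrakk>x \<in> carrier D; y \<in> carrier D\<rbrakk> \<Longrightarrow> com x y \<in> carrier D"
  by simp

lemma N_pow [simp]: "n \<in> N \<Longrightarrow> n [^] (k::nat) \<in> N"
  by (induction k) (auto simp: subgroup.one_closed[OF N_subgroup] subgroup.m_closed[OF N_subgroup])

lemma swap: "\<lbrakk>x \<in> carrier D; y \<in> carrier D\<rbrakk> \<Longrightarrow> x \<otimes> y = com x y \<otimes> (y \<otimes> x)"
proof -
  assume xy: "x \<in> carrier D" "y \<in> carrier D"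
  then have "com x y = x \<otimes> y \<otimes> inv (y \<otimes> x)"
    by (simp add: com_def m_assoc inv_mult_group)
  then show ?thesis
    using xy by (simp add: m_assoc del: inv_mult_group)
qed

lemma com_unique: "\<lbrakk>x \<in> carrier D; y \<in> carrier D; n \<in> carrier D; x \<otimes> y = n \<otimes> (y \<otimes> x)\<rbrakk> \<Longrightarrow> com x y = n"
  using swap by (metis com_closed m_closed r_cancel)

lemma left_central: "\<lbrakk>n \<in> N; x \<in> carrier D; y \<in> carrier D\<rbrakk> \<Longrightarrow> x \<otimes> (n \<otimes> y) = n \<otimes> (x \<otimes> y)"
  by (metis N_closed central m_assoc)

text \<open>Moving z to the left through y and then through x releases \<open>com y z\<close> and
  \<open>com x z\<close>; being central, both can be carried to the front.\<close>

lemma com_mult_left: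
  assumes "x \<in> carrier D" "y \<in> carrier D" "z \<in> carrier D"
  shows "com (x \<otimes> y) z = com x z \<otimes> com y z"
proof (rule com_unique)
  have "x \<otimes> y \<otimes> z = x \<otimes> (com y z \<otimes> (z \<otimes> y))"
    using assms swap[of y z] by (simp add: m_assoc)
  also have "\<dots> = com y z \<otimes> (x \<otimes> z \<otimes> y)"
    using assms left_central[of "com y z" x "z \<otimes> y"] by (simp add: m_assoc)
  also have "\<dots> = com y z \<otimes> (com x z \<otimes> (z \<otimes> x) \<otimes> y)"
    using assms swap[of x z] by simp
  also have "\<dots> = com x z \<otimes> com y z \<otimes> (z \<otimes> (x \<otimes> y))"
    using assms central[of "com y z" "com x z"] by (simp flip: m_assoc)
  finally show "x \<otimes> y \<otimes> z = com x z \<otimes> com y z \<otimes> (z \<otimes> (x \<otimes> y))" .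
qed (use assms in auto)

lemma com_swap:
  assumes "x \<in> carrier D" "y \<in> carrier D"
  shows "com y x = inv (com x y)"
proof (rule com_unique)
  have "inv (com x y) \<otimes> (x \<otimes> y) = inv (com x y) \<otimes> (com x y \<otimes> (y \<otimes> x))"
    using swap[OF assms] by (simp only:)
  then show "y \<otimes> x = inv (com x y) \<otimes> (x \<otimes> y)"
    using assms by (simp flip: m_assoc)
qed (use assms in auto)

lemma com_mult_right:
  assumes "x \<in> carrier D" "y \<in> carrier D" "z \<in> carrier D"
  shows "com z (x \<otimes> y) = com z x \<otimes> com z y"
  using assms com_mult_left[of x y z] com_swap[of "x \<otimes> y" z] com_swap[of x z] com_swap[of y z]
    central[OF com_in_N[OF assms(3,1)] com_closed[OF assms(3,2)]]
  by (simp add: inv_mult_group)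

lemma com_eq_one: "\<lbrakk>x \<in> carrier D; y \<in> carrier D; x \<otimes> y = y \<otimes> x\<rbrakk> \<Longrightarrow> com x y = \<one>"
  by (rule com_unique) auto

lemma com_N_left [simp]: "\<lbrakk>n \<in> N; x \<in> carrier D\<rbrakk> \<Longrightarrow> com n x = \<one>"
  by (metis com_eq_one central N_closed)

lemma com_N_right [simp]: "\<lbrakk>n \<in> N; x \<in> carrier D\<rbrakk> \<Longrightarrow> com x n = \<one>"
  by (metis com_eq_one central N_closed)

text \<open>The inverse of 2 modulo p, as a natural number so that it can be an exponent.\<close>

definition half :: nat where "half = (p + 1) div 2"

lemma two_half: "2 * half = p + 1"
  using p by (simp add: half_def)

lemma half_cong: "[2 * int half = 1] (mod int p)"
proof -
  have "2 * int half = 1 + int p"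
    using two_half by linarith
  then show ?thesis by (simp add: cong_def)
qed

lemma pow_half_square: "x \<in> carrier D \<Longrightarrow> x [^] half \<otimes> x [^] half = x"
  using two_half exponent[of x] by (simp add: nat_pow_mult mult_2)

text \<open>Baer's trick: halving the commutators turns a group of class two and odd exponent
  into an abelian group with the same powers.\<close>

definition baer :: "'a monoid" where
  "baer = \<lparr>carrier = carrier D, monoid.mult = (\<lambda>x y. x \<otimes> y \<otimes> com y x [^] half), one = \<one>\<rparr>"

lemma carrier_baer [simp]: "carrier baer = carrier D"
  and one_baer [simp]: "\<one>\<^bsub>baer\<^esub> = \<one>"
  and mult_baer: "x \<otimes>\<^bsub>baer\<^esub> y = x \<otimes> y \<otimes> com y x [^] half"
  by (simp_all add: baer_def)

lemma baer_mult_N: "\<lbrakk>x \<in> carrier D; n \<in> N\<rbrakk> \<Longrightarrow> x \<otimes>\<^bsub>baer\<^esub> n = x \<otimes> n"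
  by (simp add: mult_baer)

lemma com_pow_mult:
  assumes "m \<in> N" "n \<in> N"
  shows "(m \<otimes> n) [^] (k::nat) = m [^] k \<otimes> n [^] k"
  using assms by (intro pow_mult_distrib) (auto simp: central)

text \<open>By bilinearity of the commutator, both bracketings of x, y, z equal the product in D
  times half of each of the three commutators \<open>com y x\<close>, \<open>com z x\<close>,
  \<open>com z y\<close>. Commutativity holds because yx exceeds xy by the whole of
  \<open>com y x\<close>, while the correcting factors differ by that same amount in the other
  direction.\<close>

lemma baer_comm_group: "comm_group baer"
proof (rule comm_groupI)
  fix x y z assume "x \<in> carrier baer" "y \<in> carrier baer" "z \<in> carrier baer"
  then have xyz: "x \<in> carrier D" "y \<in> carrier D" "z \<in> carrier D" by simp_all
  let ?r = "com y x [^] half \<otimes> (com z x [^] half \<otimes> com z y [^] half)"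
  have "(x \<otimes>\<^bsub>baer\<^esub> y) \<otimes>\<^bsub>baer\<^esub> z =
      x \<otimes> y \<otimes> com y x [^] half \<otimes> z \<otimes> (com z x \<otimes> com z y) [^] half"
    using xyz by (simp add: mult_baer com_mult_right)
  also have "\<dots> = x \<otimes> y \<otimes> z \<otimes> ?r"
    using xyz left_central[of "com y x [^] half" z] central[of "com y x [^] half" z]
    by (simp add: com_pow_mult m_assoc)
  finally have l: "(x \<otimes>\<^bsub>baer\<^esub> y) \<otimes>\<^bsub>baer\<^esub> z = x \<otimes> y \<otimes> z \<otimes> ?r" .
  have "x \<otimes>\<^bsub>baer\<^esub> (y \<otimes>\<^bsub>baer\<^esub> z) =
      x \<otimes> (y \<otimes> z \<otimes> com z y [^] half) \<otimes> (com y x \<otimes> com z x) [^] half"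
    using xyz by (simp add: mult_baer com_mult_left)
  also have "\<dots> = x \<otimes> y \<otimes> z \<otimes> ?r"
    using xyz central[of "com z y [^] half" "com y x [^] half \<otimes> com z x [^] half"]
    by (simp add: com_pow_mult m_assoc)
  finally show "x \<otimes>\<^bsub>baer\<^esub> y \<otimes>\<^bsub>baer\<^esub> z = x \<otimes>\<^bsub>baer\<^esub> (y \<otimes>\<^bsub>baer\<^esub> z)"
    using l by simp
  have c: "com y x = com y x [^] half \<otimes> com y x [^] half"
    using xyz by (simp add: pow_half_square)
  have "y \<otimes>\<^bsub>baer\<^esub> x = com y x \<otimes> (x \<otimes> y) \<otimes> inv (com y x) [^] half"
    using xyz swap[of y x] com_swap[of y x] by (simp add: mult_baer)
  also have "\<dots> = x \<otimes> y \<otimes> (com y x \<otimes> inv (com y x [^] half))"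
    using xyz central[of "com y x" "x \<otimes> y"] by (simp add: m_assoc nat_pow_inv)
  also have "com y x \<otimes> inv (com y x [^] half) = com y x [^] half"
    using xyz by (subst c) (simp add: m_assoc)
  finally show "x \<otimes>\<^bsub>baer\<^esub> y = y \<otimes>\<^bsub>baer\<^esub> x"
    by (simp add: mult_baer)
next
  fix x assume "x \<in> carrier baer"
  then show "\<exists>y\<in>carrier baer. y \<otimes>\<^bsub>baer\<^esub> x = \<one>\<^bsub>baer\<^esub>" "\<one>\<^bsub>baer\<^esub> \<otimes>\<^bsub>baer\<^esub> x = x"
    by (auto simp: mult_baer com_eq_one intro!: bexI[of _ "inv x"])
qed (auto simp: mult_baer)

lemma nat_pow_baer: "x \<in> carrier D \<Longrightarrow> x [^]\<^bsub>baer\<^esub> (k::nat) = x [^] k"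
proof (induction k)
  case (Suc k)
  have "com x (x [^] k) = \<one>"
    using Suc.prems nat_pow_Suc2[OF Suc.prems, of k] by (intro com_eq_one) auto
  then show ?case
    using Suc by (simp add: mult_baer)
qed (simp add: nat_pow_def)

lemma N_subgroup_baer: "subgroup N baer"
proof -
  interpret B: comm_group baer by (rule baer_comm_group)
  have inv: "inv\<^bsub>baer\<^esub> n = inv n" if "n \<in> N" for n
    using that by (intro B.inv_equality) (auto simp: baer_mult_N)
  show ?thesis
    by (rule B.subgroupI)
      (use subgroup.one_closed[OF N_subgroup] subgroup.m_inv_closed[OF N_subgroup]
        subgroup.m_closed[OF N_subgroup] in \<open>auto simp: baer_mult_N inv\<close>)
qed

section \<open>Linear forms on D/N and bilinear forms modulo p\<close>

definition additive :: "('a \<Rightarrow> int) \<Rightarrow> bool" where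
  "additive k \<longleftrightarrow> (\<forall>x\<in>carrier D. \<forall>y\<in>carrier D. [k (x \<otimes> y) = k x + k y] (mod int p))"

lemma additiveD: "\<lbrakk>additive k; x \<in> carrier D; y \<in> carrier D\<rbrakk> \<Longrightarrow> [k (x \<otimes> y) = k x + k y] (mod int p)"
  by (simp add: additive_def)

lemma additive_one: "additive k \<Longrightarrow> [k \<one> = 0] (mod int p)"
  using additiveD[of k \<one> \<one>] by (simp add: cong_iff_dvd_diff)

lemma additive_com:
  assumes "additive k" "x \<in> carrier D" "y \<in> carrier D"
  shows "[k (com x y) = 0] (mod int p)"
proof -
  have "[k x + k y = k (com x y \<otimes> (y \<otimes> x))] (mod int p)"
    using additiveD[OF assms] swap[OF assms(2,3)] by (simp add: cong_sym)
  also have "[k (com x y \<otimes> (y \<otimes> x)) = k (com x y) + k (y \<otimes> x)] (mod int p)"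
    using assms by (intro additiveD) auto
  also have "[k (com x y) + k (y \<otimes> x) = k (com x y) + (k y + k x)] (mod int p)"
    using assms by (intro cong_add cong_refl additiveD) auto
  finally show ?thesis
    by (simp add: cong_iff_dvd_diff)
qed

text \<open>A homomorphism to F_p kills commutators, hence everything they generate. So linear forms
  on D are linear forms on D/N, and all corrections built from them leave the values on N
  untouched.\<close>

lemma additive_N:
  assumes "additive k" "n \<in> N"
  shows "[k n = 0] (mod int p)"
  using assms(2) unfolding N_def
proof induction
  case one
  then show ?case using additive_one assms by blast
next
  case (incl h)
  then obtain x y where "h = com x y" "x \<in> carrier D" "y \<in> carrier D"
    unfolding com_def by blast
  then show ?case
    using additive_com[OF assms(1)] by simp
next
  case (inv h)
  then obtain x y where xy: "h = com x y" "x \<in> carrier D" "y \<in> carrier D"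
    unfolding com_def by blast
  then have "inv h = com y x"
    using com_swap[of x y] by simp
  then show ?case
    using additive_com[OF assms(1) xy(3,2)] by (simp only:)
next
  case (eng h1 h2)
  have "h1 \<in> carrier D" "h2 \<in> carrier D"
    using eng.hyps N_closed[unfolded N_def] by blast+
  then show ?case
    using cong_trans[OF additiveD[OF assms(1)] cong_add[OF eng.IH]] by simp
qed

text \<open>A hyperplane \<open>W\<close> of the dual space contains all \<open>\<beta> (\<cdot>, h)\<close> after the bilinear
  form \<open>-b\<close> has been changed by a symmetric form, that is, by the coboundary of a quadratic
  form \<open>q\<close>: if \<open>-b (\<cdot>, h) \<in> c h * \<mu> + W\<close> and \<open>c \<in> t * \<mu> + W\<close>,
  subtract \<open>c \<otimes> \<mu> + \<mu> \<otimes> c - t * \<mu> \<otimes> \<mu>\<close>.\<close>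

lemma bilinear_form_into_hyperplane:
  fixes W :: "('a \<Rightarrow> int) \<Rightarrow> bool"
  assumes W_cong: "\<And>k l. \<lbrakk>W k; \<And>g. g \<in> carrier D \<Longrightarrow> [k g = l g] (mod int p)\<rbrakk> \<Longrightarrow> W l"
    and W_add: "\<And>k l. \<lbrakk>W k; W l\<rbrakk> \<Longrightarrow> W (\<lambda>g. k g + l g)"
    and W_scale: "\<And>k t. W k \<Longrightarrow> W (\<lambda>g. t * k g)"
    and W_codim: "\<And>\<chi> \<mu>. \<lbrakk>additive \<chi>; additive \<mu>; \<not> W \<mu>\<rbrakk> \<Longrightarrow> \<exists>t. W (\<lambda>g. \<chi> g - t * \<mu> g)"
    and b: "\<And>h. h \<in> carrier D \<Longrightarrow> additive (\<lambda>g. b g h)" "\<And>g. g \<in> carrier D \<Longrightarrow> additive (b g)"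
  obtains \<beta> q where "\<And>h. h \<in> carrier D \<Longrightarrow> W (\<lambda>g. \<beta> g h)" "\<And>g. g \<in> carrier D \<Longrightarrow> additive (\<beta> g)"
    "\<And>g h. \<lbrakk>g \<in> carrier D; h \<in> carrier D\<rbrakk> \<Longrightarrow> [q g + q h + \<beta> g h + b g h = q (g \<otimes> h)] (mod int p)"
    "\<And>n. n \<in> N \<Longrightarrow> [q n = 0] (mod int p)"
proof (cases "\<forall>k. additive k \<longrightarrow> W k")
  case True
  have neg: "additive (\<lambda>g. - k g)" if "additive k" for k
    using that unfolding additive_def by (metis cong_minus_minus_iff minus_add_distrib)
  show ?thesis
    by (rule that[of "\<lambda>g h. - b g h" "\<lambda>_. 0"]) (use True b neg in auto)
next
  case False
  then obtain \<mu> where lam: "additive \<mu>" "\<not> W \<mu>" by blast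
  have neg: "additive (\<lambda>g. - b g h)" if "h \<in> carrier D" for h
    using b(1)[OF that] unfolding additive_def by (metis cong_minus_minus_iff minus_add_distrib)
  have "\<exists>c. \<forall>h\<in>carrier D. W (\<lambda>g. - b g h - c h * \<mu> g)"
    using W_codim[OF neg lam] by metis
  then obtain c where c: "\<And>h. h \<in> carrier D \<Longrightarrow> W (\<lambda>g. - b g h - c h * \<mu> g)" by blast
  \<comment> \<open>\<mu> is nonzero modulo \<open>W\<close>, so coefficients along \<mu> are unique
    modulo p. This turns the pointwise choice \<open>c\<close> into a linear form.\<close>
  have dvd: "int p dvd t" if t: "W (\<lambda>g. t * \<mu> g)" for t
  proof (rule ccontr)
    assume "\<not> int p dvd t"
    then have "coprime t (int p)"
      using p by (metis coprime_commute prime_imp_coprime prime_nat_int_transfer)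
    then obtain u where u: "[t * u = 1] (mod int p)"
      using cong_solve_coprime_int by blast
    have "[u * (t * \<mu> g) = \<mu> g] (mod int p)" for g
      using cong_scalar_right[OF u, of "\<mu> g"] by (simp add: mult_ac)
    then show False
      using W_cong[OF W_scale[OF t, of u]] lam(2) by blast
  qed
  have c_add: "additive c"
    unfolding additive_def
  proof (intro ballI)
    fix x y assume xy: "x \<in> carrier D" "y \<in> carrier D"
    \<comment> \<open>Combining the memberships for xy, x and y cancels the values of
      \<open>b\<close> modulo p and leaves \<mu> times the additivity defect of
      \<open>c\<close>.\<close>
    have "W (\<lambda>g. (- b g (x \<otimes> y) - c (x \<otimes> y) * \<mu> g) + - 1 * ((- b g x - c x * \<mu> g) + (- b g y - c y * \<mu> g)))"
      using xy by (intro W_add W_scale c) auto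
    then have "W (\<lambda>g. (c x + c y - c (x \<otimes> y)) * \<mu> g)"
    proof (rule W_cong)
      fix g assume g: "g \<in> carrier D"
      have "int p dvd b g x + b g y - b g (x \<otimes> y)"
        using additiveD[OF b(2)[OF g] xy] by (simp add: cong_iff_dvd_diff dvd_diff_commute)
      then show "[(- b g (x \<otimes> y) - c (x \<otimes> y) * \<mu> g) + - 1 * ((- b g x - c x * \<mu> g) + (- b g y - c y * \<mu> g)) =
          (c x + c y - c (x \<otimes> y)) * \<mu> g] (mod int p)"
        by (simp add: cong_iff_dvd_diff algebra_simps)
    qed
    then show "[c (x \<otimes> y) = c x + c y] (mod int p)"
      using dvd by (simp add: cong_iff_dvd_diff dvd_diff_commute)
  qed
  obtain t where t: "W (\<lambda>g. c g - t * \<mu> g)"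
    using W_codim[OF c_add lam] by blast
  define \<beta> where "\<beta> g h = - b g h - c h * \<mu> g - \<mu> h * c g + t * \<mu> h * \<mu> g" for g h
  \<comment> \<open>\<open>q\<close> is chosen so that q(gh) - q(g) - q(h) is \<beta> + b. The
    product of \<open>c\<close> and \<mu> polarises to the two mixed terms; the square of \<mu>
    polarises to twice the wanted term, hence the factor \<open>half\<close>.\<close>
  define q where "q g = t * int half * (\<mu> g * \<mu> g) - c g * \<mu> g" for g
  show ?thesis
  proof (rule that[of \<beta> q])
    fix h assume "h \<in> carrier D"
    then have "W (\<lambda>g. (- b g h - c h * \<mu> g) + - \<mu> h * (c g - t * \<mu> g))"
      by (intro W_add W_scale c t)
    then show "W (\<lambda>g. \<beta> g h)"
      by (rule W_cong) (simp add: \<beta>_def algebra_simps)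
  next
    fix g assume g: "g \<in> carrier D"
    show "additive (\<beta> g)"
      unfolding additive_def
    proof (intro ballI)
      fix x y assume xy: "x \<in> carrier D" "y \<in> carrier D"
      have "[\<beta> g (x \<otimes> y) = - (b g x + b g y) - (c x + c y) * \<mu> g - (\<mu> x + \<mu> y) * c g + t * (\<mu> x + \<mu> y) * \<mu> g] (mod int p)"
        unfolding \<beta>_def
        by (intro cong_add cong_diff cong_mult cong_refl cong_minus_minus_iff[THEN iffD2]
            additiveD[OF b(2)[OF g] xy] additiveD[OF lam(1) xy] additiveD[OF c_add xy])
      then show "[\<beta> g (x \<otimes> y) = \<beta> g x + \<beta> g y] (mod int p)"
        by (simp add: \<beta>_def algebra_simps)
    qed
  next
    fix g h assume gh: "g \<in> carrier D" "h \<in> carrier D"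
    have "[q (g \<otimes> h) = t * int half * ((\<mu> g + \<mu> h) * (\<mu> g + \<mu> h)) - (c g + c h) * (\<mu> g + \<mu> h)] (mod int p)"
      unfolding q_def
      by (intro cong_diff cong_mult cong_refl additiveD[OF lam(1) gh] additiveD[OF c_add gh])
    also have "t * int half * ((\<mu> g + \<mu> h) * (\<mu> g + \<mu> h)) - (c g + c h) * (\<mu> g + \<mu> h)
        = q g + q h + (2 * int half) * (t * \<mu> g * \<mu> h) - c g * \<mu> h - c h * \<mu> g"
      by (simp add: q_def algebra_simps)
    also have "[\<dots> = q g + q h + 1 * (t * \<mu> g * \<mu> h) - c g * \<mu> h - c h * \<mu> g] (mod int p)"
      by (intro cong_diff cong_add cong_mult cong_refl half_cong)
    also have "q g + q h + 1 * (t * \<mu> g * \<mu> h) - c g * \<mu> h - c h * \<mu> g = q g + q h + \<beta> g h + b g h"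
      by (simp add: \<beta>_def algebra_simps)
    finally show "[q g + q h + \<beta> g h + b g h = q (g \<otimes> h)] (mod int p)"
      by (rule cong_sym)
  next
    fix n assume "n \<in> N"
    then have "[q n = t * int half * (0 * 0) - 0 * 0] (mod int p)"
      unfolding q_def
      by (intro cong_diff cong_mult cong_refl additive_N[OF lam(1)] additive_N[OF c_add])
    then show "[q n = 0] (mod int p)" by simp
  qed
qed

end

subsection \<open>Crossed homomorphisms and inflation\<close>

text \<open>As x is not in H, the cosets of 1, x, ..., x^(p-1) are distinct, so they exhaust the at
  most p cosets of H. With H the group of coboundaries this turns the bound on the order of H^1 into
  a statement of codimension at most 1.\<close>

lemma (in comm_group) subgroup_index_le_prime:
  assumes p: "Factorial_Ring.prime p" and H: "subgroup H G"
    and index: "finite (rcosets H)" "card (rcosets H) \<le> p"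
    and x: "x \<in> carrier G" "x [^] p = \<one>" "x \<notin> H" and y: "y \<in> carrier G"
  shows "\<exists>t::int. y \<otimes> x [^] t \<in> H"
proof -
  let ?c = "\<lambda>t::int. H #> x [^] t"
  have sub: "?c ` {0..<int p} \<subseteq> rcosets H"
    using x by (auto simp: RCOSETS_def)
  have inj: "inj_on ?c {0..<int p}"
  proof (rule inj_onI)
    fix t u :: int assume tu: "t \<in> {0..<int p}" "u \<in> {0..<int p}" and eq: "?c t = ?c u"
    have "x [^] t \<in> ?c u"
      using rcos_self[OF _ H, of "x [^] t"] x eq by simp
    then obtain h where h: "h \<in> H" "x [^] t = h \<otimes> x [^] u"
      by (auto simp: r_coset_def)
    then have "x [^] (t - u) = h"
      using x subgroup.mem_carrier[OF H h(1)] by (simp add: int_pow_diff m_assoc)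
    then have "int p dvd t - u"
      using int_pow_mem_subgroup_imp_dvd[OF p x(1,2) H x(3)] h by blast
    then have "t mod int p = u mod int p"
      by (simp add: mod_eq_dvd_iff)
    then show "t = u"
      using tu by simp
  qed
  have "?c ` {0..<int p} = rcosets H"
    using sub index card_image[OF inj] by (intro card_seteq) auto
  \<comment> \<open>The coset of the inverse of y is located, so that the power of x ends up
    multiplied to y itself.\<close>
  moreover have "H #> inv y \<in> rcosets H"
    using y by (auto simp: RCOSETS_def)
  ultimately obtain t where t: "H #> inv y = ?c t" by auto
  then have "inv y \<in> ?c t"
    using rcos_self[OF _ H, of "inv y"] y by simp
  then obtain h where h: "h \<in> H" "inv y = h \<otimes> x [^] t"
    by (auto simp: r_coset_def)
  note hc = subgroup.mem_carrier[OF H h(1)]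
  have "x [^] t = inv h \<otimes> (h \<otimes> x [^] t)"
    using hc x by (simp flip: m_assoc)
  also have "\<dots> = inv h \<otimes> inv y"
    by (simp only: h(2))
  finally have "y \<otimes> x [^] t = inv h"
    using hc y by (simp add: m_lcomm[of y])
  then show ?thesis
    using h subgroup.m_inv_closed[OF H] by metis
qed

locale fp_module = L: group L + M: comm_group M
  for L :: "('g, 'c) monoid_scheme" and M :: "('m, 'e) monoid_scheme" +
  fixes p :: nat and act :: "'g \<Rightarrow> 'm \<Rightarrow> 'm"
  assumes Fp_module: "Fp_module p L M act"

lemma fp_moduleI: "Fp_module p L M act \<Longrightarrow> fp_module L M p act"
  by (simp add: Fp_module_def fp_module_def fp_module_axioms_def)

context fp_module
begin

abbreviation "Z1 \<equiv> Z1_group L M act"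
abbreviation "B1 \<equiv> principal_crossed_homs L M act"

lemma M_exponent: "m \<in> carrier M \<Longrightarrow> m [^]\<^bsub>M\<^esub> p = \<one>\<^bsub>M\<^esub>"
  using Fp_module by (simp add: Fp_module_def)

lemma act_group_hom: "g \<in> carrier L \<Longrightarrow> group_hom M M (act g)"
  using Fp_module by (intro group_hom.intro group_hom_axioms.intro M.is_group) (simp add: Fp_module_def)

lemma act_closed [simp]: "\<lbrakk>g \<in> carrier L; m \<in> carrier M\<rbrakk> \<Longrightarrow> act g m \<in> carrier M"
  using group_hom.hom_closed[OF act_group_hom] .

lemma act_mult [simp]:
  "\<lbrakk>g \<in> carrier L; m \<in> carrier M; m' \<in> carrier M\<rbrakk> \<Longrightarrow> act g (m \<otimes>\<^bsub>M\<^esub> m') = act g m \<otimes>\<^bsub>M\<^esub> act g m'"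
  using group_hom.hom_mult[OF act_group_hom] .

lemma act_one [simp]: "g \<in> carrier L \<Longrightarrow> act g \<one>\<^bsub>M\<^esub> = \<one>\<^bsub>M\<^esub>"
  using group_hom.hom_one[OF act_group_hom] .

lemma act_inv [simp]: "\<lbrakk>g \<in> carrier L; m \<in> carrier M\<rbrakk> \<Longrightarrow> act g (inv\<^bsub>M\<^esub> m) = inv\<^bsub>M\<^esub> (act g m)"
  using group_hom.hom_inv[OF act_group_hom] .

lemma act_int_pow: "\<lbrakk>g \<in> carrier L; m \<in> carrier M\<rbrakk> \<Longrightarrow> act g (m [^]\<^bsub>M\<^esub> (k::int)) = act g m [^]\<^bsub>M\<^esub> k"
  using group_hom.hom_int_pow[OF act_group_hom] .

lemma one_act [simp]: "m \<in> carrier M \<Longrightarrow> act \<one>\<^bsub>L\<^esub> m = m"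
  using Fp_module by (simp add: Fp_module_def)

lemma mult_act:
  "\<lbrakk>g \<in> carrier L; h \<in> carrier L; m \<in> carrier M\<rbrakk> \<Longrightarrow> act (g \<otimes>\<^bsub>L\<^esub> h) m = act g (act h m)"
  using Fp_module by (simp add: Fp_module_def)

lemma carrier_Z1 [simp]: "carrier Z1 = crossed_homs L M act"
  and one_Z1: "\<one>\<^bsub>Z1\<^esub> = (\<lambda>g\<in>carrier L. \<one>\<^bsub>M\<^esub>)"
  and mult_Z1: "f \<otimes>\<^bsub>Z1\<^esub> f' = (\<lambda>g\<in>carrier L. f g \<otimes>\<^bsub>M\<^esub> f' g)"
  by (simp_all add: Z1_group_def)

lemma crossed_hom_closed [simp]:
  "\<lbrakk>f \<in> crossed_homs L M act; g \<in> carrier L\<rbrakk> \<Longrightarrow> f g \<in> carrier M"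
  by (auto simp: crossed_homs_def)

lemma crossed_hom_mult:
  "\<lbrakk>f \<in> crossed_homs L M act; g \<in> carrier L; h \<in> carrier L\<rbrakk>
    \<Longrightarrow> f (g \<otimes>\<^bsub>L\<^esub> h) = f g \<otimes>\<^bsub>M\<^esub> act g (f h)"
  by (auto simp: crossed_homs_def)

lemma crossed_hom_eqI:
  "\<lbrakk>f \<in> crossed_homs L M act; f' \<in> crossed_homs L M act; \<And>g. g \<in> carrier L \<Longrightarrow> f g = f' g\<rbrakk> \<Longrightarrow> f = f'"
  by (rule PiE_ext) (auto simp: crossed_homs_def)

lemma restrict_crossed_homI:
  assumes "\<And>g. g \<in> carrier L \<Longrightarrow> f g \<in> carrier M"
    "\<And>g h. \<lbrakk>g \<in> carrier L; h \<in> carrier L\<rbrakk> \<Longrightarrow> f (g \<otimes>\<^bsub>L\<^esub> h) = f g \<otimes>\<^bsub>M\<^esub> act g (f h)"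
  shows "restrict f (carrier L) \<in> crossed_homs L M act"
  using assms by (simp add: crossed_homs_def)

lemma Z1_comm_group: "comm_group Z1"
proof (rule comm_groupI)
  fix f f' assume "f \<in> carrier Z1" "f' \<in> carrier Z1"
  then have ff': "f \<in> crossed_homs L M act" "f' \<in> crossed_homs L M act" by simp_all
  show "f \<otimes>\<^bsub>Z1\<^esub> f' \<in> carrier Z1"
    unfolding mult_Z1 carrier_Z1
    using ff' by (intro restrict_crossed_homI) (simp_all add: crossed_hom_mult M.m_ac)
  show "f \<otimes>\<^bsub>Z1\<^esub> f' = f' \<otimes>\<^bsub>Z1\<^esub> f"
    unfolding mult_Z1 using ff' by (intro restrict_ext) (simp add: M.m_comm)
next
  show "\<one>\<^bsub>Z1\<^esub> \<in> carrier Z1"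
    unfolding one_Z1 carrier_Z1 by (intro restrict_crossed_homI) simp_all
next
  fix f assume "f \<in> carrier Z1"
  then have f: "f \<in> crossed_homs L M act" by simp
  have "(\<lambda>g\<in>carrier L. inv\<^bsub>M\<^esub> (f g)) \<in> crossed_homs L M act"
    using f by (intro restrict_crossed_homI) (simp_all add: crossed_hom_mult M.inv_mult)
  then show "\<exists>f'\<in>carrier Z1. f' \<otimes>\<^bsub>Z1\<^esub> f = \<one>\<^bsub>Z1\<^esub>"
    unfolding one_Z1 carrier_Z1 mult_Z1
    by (rule rev_bexI) (rule restrict_ext, use f in simp)
  have "restrict f (carrier L) = f"
    using f by (auto simp: crossed_homs_def PiE_restrict)
  then show "\<one>\<^bsub>Z1\<^esub> \<otimes>\<^bsub>Z1\<^esub> f = f"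
    unfolding one_Z1 mult_Z1 using f by (simp cong: restrict_cong)
next
  fix f f' f'' assume "f \<in> carrier Z1" "f' \<in> carrier Z1" "f'' \<in> carrier Z1"
  then show "f \<otimes>\<^bsub>Z1\<^esub> f' \<otimes>\<^bsub>Z1\<^esub> f'' = f \<otimes>\<^bsub>Z1\<^esub> (f' \<otimes>\<^bsub>Z1\<^esub> f'')"
    unfolding mult_Z1 by (intro restrict_ext) (simp add: M.m_assoc)
qed

sublocale Z1: comm_group Z1
  by (rule Z1_comm_group)

lemma eval_group_hom: "g \<in> carrier L \<Longrightarrow> group_hom Z1 M (\<lambda>f. f g)"
  by (intro group_hom.intro group_hom_axioms.intro M.is_group Z1.is_group homI) (auto simp: mult_Z1)

lemma Z1_int_pow_apply:
  "\<lbrakk>f \<in> crossed_homs L M act; g \<in> carrier L\<rbrakk> \<Longrightarrow> (f [^]\<^bsub>Z1\<^esub> (k::int)) g = f g [^]\<^bsub>M\<^esub> k"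
  using group_hom.hom_int_pow[OF eval_group_hom, of g f k] by simp

lemma Z1_exponent: "f \<in> carrier Z1 \<Longrightarrow> f [^]\<^bsub>Z1\<^esub> p = \<one>\<^bsub>Z1\<^esub>"
proof (rule crossed_hom_eqI)
  fix g assume "f \<in> carrier Z1" "g \<in> carrier L"
  then show "(f [^]\<^bsub>Z1\<^esub> p) g = \<one>\<^bsub>Z1\<^esub> g"
    using group_hom.hom_nat_pow[OF eval_group_hom, of g f p] M_exponent by (simp add: one_Z1)
next
  assume "f \<in> carrier Z1"
  then show "f [^]\<^bsub>Z1\<^esub> p \<in> crossed_homs L M act"
    using Z1.nat_pow_closed by simp
next
  show "\<one>\<^bsub>Z1\<^esub> \<in> crossed_homs L M act"
    using Z1.one_closed by simp
qed

lemma B1_subgroup: "subgroup B1 Z1"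
proof -
  let ?d = "\<lambda>m. \<lambda>g\<in>carrier L. act g m \<otimes>\<^bsub>M\<^esub> inv\<^bsub>M\<^esub> m"
  \<comment> \<open>This is the cocycle identity of a coboundary: a = g m, b = (gh) m, c =
    m.\<close>
  have cancel: "a \<otimes>\<^bsub>M\<^esub> inv\<^bsub>M\<^esub> c \<otimes>\<^bsub>M\<^esub> (b \<otimes>\<^bsub>M\<^esub> inv\<^bsub>M\<^esub> a) = b \<otimes>\<^bsub>M\<^esub> inv\<^bsub>M\<^esub> c"
    if "a \<in> carrier M" "b \<in> carrier M" "c \<in> carrier M" for a b c
  proof -
    have "a \<otimes>\<^bsub>M\<^esub> inv\<^bsub>M\<^esub> c \<otimes>\<^bsub>M\<^esub> (b \<otimes>\<^bsub>M\<^esub> inv\<^bsub>M\<^esub> a) = b \<otimes>\<^bsub>M\<^esub> inv\<^bsub>M\<^esub> c \<otimes>\<^bsub>M\<^esub> (a \<otimes>\<^bsub>M\<^esub> inv\<^bsub>M\<^esub> a)"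
      using that by (simp only: M.m_ac M.m_closed M.inv_closed)
    then show ?thesis using that by simp
  qed
  have "?d \<in> hom M Z1"
  proof (rule homI)
    fix m assume m: "m \<in> carrier M"
    show "?d m \<in> carrier Z1"
      unfolding carrier_Z1
      using m by (intro restrict_crossed_homI) (simp_all add: mult_act cancel)
    fix m' assume m': "m' \<in> carrier M"
    show "?d (m \<otimes>\<^bsub>M\<^esub> m') = ?d m \<otimes>\<^bsub>Z1\<^esub> ?d m'"
      unfolding mult_Z1 using m m' by (intro restrict_ext) (simp add: M.inv_mult M.m_ac)
  qed
  then interpret d: group_hom M Z1 ?d
    by unfold_locales
  show ?thesis
    unfolding principal_crossed_homs_def by (rule d.img_is_subgroup)
qed

lemma H1_carrier: "carrier (H1 L M act) = rcosets\<^bsub>Z1\<^esub> B1"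
  by (simp add: H1_def FactGroup_def)

lemma fixed_points_subgroup: "subgroup (fixed_points L M act) M"
  by (rule M.subgroupI) (auto simp: fixed_points_def intro!: exI[of _ "\<one>\<^bsub>M\<^esub>"])

text \<open>The given isomorphism, read as a discrete logarithm \<open>lg\<close> to the base z,
  where z is the preimage of 1. Its values are the residues in [0, p), the carrier of
  \<open>integer_mod_group p\<close>.\<close>

lemma fixed_points_generator:
  assumes p: "p > 1" and iso: "M\<lparr>carrier := fixed_points L M act\<rparr> \<cong> integer_mod_group p"
  shows "\<exists>z lg. z \<in> fixed_points L M act \<and>
    (\<forall>x\<in>fixed_points L M act. 0 \<le> lg x \<and> lg x < int p \<and> x = z [^]\<^bsub>M\<^esub> lg x) \<and>
    (\<forall>k::int. lg (z [^]\<^bsub>M\<^esub> k) = k mod int p) \<and>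
    (\<forall>x\<in>fixed_points L M act. \<forall>y\<in>fixed_points L M act. lg (x \<otimes>\<^bsub>M\<^esub> y) = (lg x + lg y) mod int p)"
proof -
  let ?F = "M\<lparr>carrier := fixed_points L M act\<rparr>"
  obtain lg where lg: "lg \<in> iso ?F (integer_mod_group p)"
    using iso by (auto simp: is_iso_def)
  have F: "group ?F"
    by (rule M.subgroup_imp_group[OF fixed_points_subgroup])
  interpret lg: group_hom ?F "integer_mod_group p" lg
    using lg F by (intro group_hom.intro group_hom_axioms.intro) (auto simp: iso_def)
  have surj: "lg ` fixed_points L M act = {0..<int p}" and inj: "inj_on lg (fixed_points L M act)"
    using lg p by (auto simp: iso_def bij_betw_def carrier_integer_mod_group)
  have "1 \<in> lg ` fixed_points L M act"
    unfolding surj using p by simp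
  then obtain z where z: "z \<in> fixed_points L M act" "lg z = 1" by auto
  have pow: "lg (z [^]\<^bsub>M\<^esub> k) = k mod int p" for k :: int
    using lg.hom_int_pow[of z k] z M.int_pow_consistent[OF fixed_points_subgroup z(1)]
    by (simp add: int_pow_integer_mod_group)
  have zF: "z [^]\<^bsub>M\<^esub> k \<in> fixed_points L M act" for k :: int
    by (rule M.subgroup_int_pow_closed[OF fixed_points_subgroup z(1)])
  have bound: "0 \<le> lg x \<and> lg x < int p" if "x \<in> fixed_points L M act" for x
    using surj that by (metis atLeastLessThan_iff imageI)
  have "x = z [^]\<^bsub>M\<^esub> lg x" if "x \<in> fixed_points L M act" for x
    by (rule inj_onD[OF inj]) (use that zF bound pow in simp_all)
  then show ?thesis
    using z pow bound lg.hom_mult by (intro exI[of _ z] exI[of _ lg]) simp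
qed

end

section \<open>Inflation of crossed homomorphisms from G/N to G\<close>

definition inflate :: "('g, 'c) monoid_scheme \<Rightarrow> 'g set \<Rightarrow> ('g set \<Rightarrow> 'm) \<Rightarrow> 'g \<Rightarrow> 'm" where
  "inflate G N u = (\<lambda>g\<in>carrier G. u (N #>\<^bsub>G\<^esub> g))"

locale inflated_module = normal N G + Q: fp_module "G Mod N" M p act
  for N and G (structure) and M :: "('m, 'e) monoid_scheme" and p act
begin

lemma coset_closed [simp]: "g \<in> carrier G \<Longrightarrow> N #> g \<in> carrier (G Mod N)"
  by (auto simp: carrier_FactGroup)

lemma coset_mult [simp]:
  "\<lbrakk>g \<in> carrier G; h \<in> carrier G\<rbrakk> \<Longrightarrow> N #> (g \<otimes> h) = (N #> g) \<otimes>\<^bsub>G Mod N\<^esub> (N #> h)"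
  by (simp add: rcos_sum)

lemma coset_N: "n \<in> N \<Longrightarrow> N #> n = \<one>\<^bsub>G Mod N\<^esub>"
  using rcos_const by simp

lemma Fp_module_pullback: "Fp_module p G M (\<lambda>g. act (N #> g))"
  using Q.Fp_module coset_N[OF subgroup.one_closed[OF subgroup_axioms]] unfolding Fp_module_def
  by (auto simp del: mult_FactGroup)

sublocale P: fp_module G M p "\<lambda>g. act (N #> g)"
  by (rule fp_moduleI[OF Fp_module_pullback])

lemma N_acts_trivially: "\<lbrakk>n \<in> N; m \<in> carrier M\<rbrakk> \<Longrightarrow> act (N #> n) m = m"
  by (metis coset_N Q.one_act)

lemma inflate_apply [simp]: "g \<in> carrier G \<Longrightarrow> inflate G N u g = u (N #> g)"
  by (simp add: inflate_def)

lemma inflate_closed: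
  "u \<in> crossed_homs (G Mod N) M act \<Longrightarrow> inflate G N u \<in> crossed_homs G M (\<lambda>g. act (N #> g))"
  unfolding inflate_def
  by (intro P.restrict_crossed_homI) (simp_all add: Q.crossed_hom_mult del: mult_FactGroup)

lemma inflate_hom: "inflate G N \<in> hom Q.Z1 P.Z1"
proof (rule homI)
  fix u v assume "u \<in> carrier Q.Z1" "v \<in> carrier Q.Z1"
  then show "inflate G N (u \<otimes>\<^bsub>Q.Z1\<^esub> v) = inflate G N u \<otimes>\<^bsub>P.Z1\<^esub> inflate G N v"
    by (simp add: P.mult_Z1 Q.mult_Z1 inflate_def cong: restrict_cong)
qed (simp add: inflate_closed)

lemma inflate_inj: "inj_on (inflate G N) (crossed_homs (G Mod N) M act)"
proof (rule inj_onI)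
  fix u v assume uv: "u \<in> crossed_homs (G Mod N) M act" "v \<in> crossed_homs (G Mod N) M act"
    and eq: "inflate G N u = inflate G N v"
  show "u = v"
  proof (rule Q.crossed_hom_eqI[OF uv])
    fix C assume "C \<in> carrier (G Mod N)"
    then obtain g where "g \<in> carrier G" "C = N #> g"
      by (auto simp: carrier_FactGroup)
    then show "u C = v C"
      using fun_cong[OF eq, of g] by simp
  qed
qed

text \<open>As N acts trivially, f(ng) = f(n) f(g) = f(g) in multiplicative notation. So f is
  constant on cosets, and evaluating it at an arbitrary representative defines its descent to
  G/N.\<close>

lemma inflate_onto:
  assumes f: "f \<in> crossed_homs G M (\<lambda>g. act (N #> g))" and N: "\<And>n. n \<in> N \<Longrightarrow> f n = \<one>\<^bsub>M\<^esub>"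
  shows "f \<in> inflate G N ` crossed_homs (G Mod N) M act"
proof -
  define u where "u C = f (SOME g. g \<in> C)" for C
  have u: "u (N #> g) = f g" if g: "g \<in> carrier G" for g
  proof -
    have "(SOME h. h \<in> N #> g) \<in> N #> g"
      by (rule someI[of _ g]) (rule rcos_self[OF g subgroup_axioms])
    then obtain n where n: "n \<in> N" "(SOME h. h \<in> N #> g) = n \<otimes> g"
      by (auto simp: r_coset_def)
    then show ?thesis
      using P.crossed_hom_mult[OF f _ g, of n] f g N by (simp add: u_def N_acts_trivially)
  qed
  have "restrict u (carrier (G Mod N)) \<in> crossed_homs (G Mod N) M act"
  proof (rule Q.restrict_crossed_homI)
    fix C assume "C \<in> carrier (G Mod N)"
    then obtain g where g: "g \<in> carrier G" "C = N #> g"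
      by (auto simp: carrier_FactGroup)
    then show "u C \<in> carrier M"
      using u f by simp
    fix C' assume "C' \<in> carrier (G Mod N)"
    then obtain h where h: "h \<in> carrier G" "C' = N #> h"
      by (auto simp: carrier_FactGroup)
    have "u (N #> (g \<otimes> h)) = u (N #> g) \<otimes>\<^bsub>M\<^esub> act (N #> g) (u (N #> h))"
      using g h u P.crossed_hom_mult[OF f] by (simp del: coset_mult)
    then show "u (C \<otimes>\<^bsub>G Mod N\<^esub> C') = u C \<otimes>\<^bsub>M\<^esub> act C (u C')"
      using g h by (simp del: mult_FactGroup)
  qed
  moreover have "f = inflate G N (restrict u (carrier (G Mod N)))"
    by (rule P.crossed_hom_eqI[OF f inflate_closed[OF calculation]]) (simp add: u)
  ultimately show ?thesis by blast
qed

text \<open>The coboundary of m over G/N inflates to the coboundary of the same m over G; together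
  with injectivity on cocycles this makes inflation injective on cohomology.\<close>

lemma inflate_in_B1_iff:
  assumes "u \<in> crossed_homs (G Mod N) M act"
  shows "inflate G N u \<in> P.B1 \<longleftrightarrow> u \<in> Q.B1"
proof -
  let ?d = "\<lambda>m. \<lambda>C\<in>carrier (G Mod N). act C m \<otimes>\<^bsub>M\<^esub> inv\<^bsub>M\<^esub> m"
  have eq: "inflate G N (?d m) = (\<lambda>g\<in>carrier G. act (N #> g) m \<otimes>\<^bsub>M\<^esub> inv\<^bsub>M\<^esub> m)" for m
    by (simp add: inflate_def cong: restrict_cong)
  have d: "?d m \<in> crossed_homs (G Mod N) M act" if "m \<in> carrier M" for m
    using that subgroup.subset[OF Q.B1_subgroup] by (auto simp: principal_crossed_homs_def)
  have "inflate G N u \<in> P.B1 \<longleftrightarrow> (\<exists>m\<in>carrier M. inflate G N u = inflate G N (?d m))"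
    unfolding eq by (auto simp: principal_crossed_homs_def)
  also have "\<dots> \<longleftrightarrow> (\<exists>m\<in>carrier M. u = ?d m)"
    using inj_on_eq_iff[OF inflate_inj assms d] by (intro bex_cong) auto
  also have "\<dots> \<longleftrightarrow> u \<in> Q.B1"
    by (auto simp: principal_crossed_homs_def)
  finally show ?thesis .
qed

end

subsection \<open>Extension of homomorphisms to crossed homomorphisms\<close>

text \<open>Three defects cancel. In additive notation psi(gh) = psi(g) + psi(h) - b(g,h) z, the
  action gives g psi(h) = psi(h) + beta(g,h) z, and q(gh) exceeds q(g) + q(h) by beta(g,h) + b(g,h);
  hence psi + q z is a crossed homomorphism. The premise \<open>codim\<close> states in elementary
  terms that the linear forms k for which k z is a coboundary have codimension at most 1.\<close>

lemma (in class_two_group) extend_to_crossed_hom: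
  fixes K :: "('m, 'e) monoid_scheme"
  assumes module: "Fp_module p D K act"
    and trivial: "\<And>n m. \<lbrakk>n \<in> N; m \<in> carrier K\<rbrakk> \<Longrightarrow> act n m = m"
    and z: "z \<in> fixed_points D K act"
    and codim: "\<And>\<chi> \<mu>. \<lbrakk>additive \<chi>; additive \<mu>;
        \<not> (\<exists>m\<in>carrier K. \<forall>g\<in>carrier D. act g m = m \<otimes>\<^bsub>K\<^esub> z [^]\<^bsub>K\<^esub> \<mu> g)\<rbrakk>
      \<Longrightarrow> \<exists>t::int. \<exists>m\<in>carrier K. \<forall>g\<in>carrier D. act g m = m \<otimes>\<^bsub>K\<^esub> z [^]\<^bsub>K\<^esub> (\<chi> g - t * \<mu> g)"
    and \<phi>: "\<And>m n. \<lbrakk>m \<in> N; n \<in> N\<rbrakk> \<Longrightarrow> [\<phi> (m \<otimes> n) = \<phi> m + \<phi> n] (mod int p)"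
  obtains f where "f \<in> crossed_homs D K act" "\<And>n. n \<in> N \<Longrightarrow> f n = z [^]\<^bsub>K\<^esub> (\<phi> n :: int)"
proof -
  interpret K: fp_module D K p act
    by (rule fp_moduleI[OF module])
  have zc: "z \<in> carrier K" and z_fix: "\<And>g. g \<in> carrier D \<Longrightarrow> act g z = z"
    using z by (auto simp: fixed_points_def)
  note zp = K.M_exponent[OF zc]
  have z_cong: "z [^]\<^bsub>K\<^esub> k = z [^]\<^bsub>K\<^esub> l" if "[k = l] (mod int p)" for k l :: int
    by (rule K.M.int_pow_exponent_cong[OF zc zp that])
  have act_z: "act g (z [^]\<^bsub>K\<^esub> (k::int)) = z [^]\<^bsub>K\<^esub> k" if "g \<in> carrier D" for g k
    using that zc z_fix by (simp add: K.act_int_pow)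
  define W where "W k \<longleftrightarrow> (\<exists>m\<in>carrier K. \<forall>g\<in>carrier D. act g m = m \<otimes>\<^bsub>K\<^esub> z [^]\<^bsub>K\<^esub> (k g :: int))" for k
  \<comment> \<open>The order \<open>com h g\<close> is that of the correcting factor in the Baer
    product of g and h.\<close>
  define b where "b g h = int half * \<phi> (com h g)" for g h
  have b1: "additive (\<lambda>g. b g h)" if "h \<in> carrier D" for h
    unfolding additive_def
  proof (intro ballI)
    fix x y assume "x \<in> carrier D" "y \<in> carrier D"
    then have "[b (x \<otimes> y) h = int half * (\<phi> (com h x) + \<phi> (com h y))] (mod int p)"
      unfolding b_def using that by (simp only: com_mult_right) (intro cong_mult cong_refl \<phi>; simp)
    then show "[b (x \<otimes> y) h = b x h + b y h] (mod int p)"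
      by (simp add: b_def distrib_left)
  qed
  have b2: "additive (b g)" if "g \<in> carrier D" for g
    unfolding additive_def
  proof (intro ballI)
    fix x y assume "x \<in> carrier D" "y \<in> carrier D"
    then have "[b g (x \<otimes> y) = int half * (\<phi> (com x g) + \<phi> (com y g))] (mod int p)"
      unfolding b_def using that by (simp only: com_mult_left) (intro cong_mult cong_refl \<phi>; simp)
    then show "[b g (x \<otimes> y) = b g x + b g y] (mod int p)"
      by (simp add: b_def distrib_left)
  qed
  obtain \<beta> q where \<beta>: "\<And>h. h \<in> carrier D \<Longrightarrow> W (\<lambda>g. \<beta> g h)" "\<And>g. g \<in> carrier D \<Longrightarrow> additive (\<beta> g)"
    and q: "\<And>g h. \<lbrakk>g \<in> carrier D; h \<in> carrier D\<rbrakk> \<Longrightarrow> [q g + q h + \<beta> g h + b g h = q (g \<otimes> h)] (mod int p)"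
      "\<And>n. n \<in> N \<Longrightarrow> [q n = 0] (mod int p)"
  proof (rule bilinear_form_into_hyperplane[of W b])
    fix k l assume "W k" and eq: "\<And>g. g \<in> carrier D \<Longrightarrow> [k g = l g] (mod int p)"
    then show "W l"
      unfolding W_def using z_cong[OF eq] by metis
  next
    fix k l assume "W k" "W l"
    then obtain m m' where m: "m \<in> carrier K" "\<And>g. g \<in> carrier D \<Longrightarrow> act g m = m \<otimes>\<^bsub>K\<^esub> z [^]\<^bsub>K\<^esub> k g"
      "m' \<in> carrier K" "\<And>g. g \<in> carrier D \<Longrightarrow> act g m' = m' \<otimes>\<^bsub>K\<^esub> z [^]\<^bsub>K\<^esub> l g"
      by (auto simp: W_def)
    then show "W (\<lambda>g. k g + l g)"
      unfolding W_def using zc by (intro bexI[of _ "m \<otimes>\<^bsub>K\<^esub> m'"]) (simp_all add: K.M.int_pow_mult K.M.m_ac)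
  next
    fix k and t :: int assume "W k"
    then obtain m where m: "m \<in> carrier K" "\<And>g. g \<in> carrier D \<Longrightarrow> act g m = m \<otimes>\<^bsub>K\<^esub> z [^]\<^bsub>K\<^esub> k g"
      by (auto simp: W_def)
    then show "W (\<lambda>g. t * k g)"
      unfolding W_def using zc
      by (intro bexI[of _ "m [^]\<^bsub>K\<^esub> t"])
        (simp_all add: K.act_int_pow K.M.int_pow_distrib K.M.int_pow_pow mult.commute)
  next
    fix \<chi> \<mu> assume "additive \<chi>" "additive \<mu>" "\<not> W \<mu>"
    then show "\<exists>t. W (\<lambda>g. \<chi> g - t * \<mu> g)"
      unfolding W_def by (rule codim)
  qed (use b1 b2 in auto)
  \<comment> \<open>The relation between h and m is the family of equations g m = m + beta(g,h) z.
    It is total because each beta(.,h) lies in \<open>W\<close>, and multiplicative because beta is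
    additive in h. On N the prescribed values satisfy it, since z is fixed and beta(g,.) vanishes
    there.\<close>
  have "\<exists>\<psi>\<in>hom baer K. (\<forall>n\<in>N. \<psi> n = z [^]\<^bsub>K\<^esub> \<phi> n) \<and>
      (\<forall>h\<in>carrier baer. \<forall>g\<in>carrier D. act g (\<psi> h) = \<psi> h \<otimes>\<^bsub>K\<^esub> z [^]\<^bsub>K\<^esub> \<beta> g h)"
  proof (rule hom_extension_within_relation[OF p(1) baer_comm_group _ _ K.M.comm_group_axioms])
    show "finite (carrier baer)" using fin by simp
    show "x [^]\<^bsub>baer\<^esub> p = \<one>\<^bsub>baer\<^esub>" if "x \<in> carrier baer" for x
      using that exponent by (simp add: nat_pow_baer)
    show "x [^]\<^bsub>K\<^esub> p = \<one>\<^bsub>K\<^esub>" if "x \<in> carrier K" for x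
      using that by (rule K.M_exponent)
    show "\<exists>m\<in>carrier K. \<forall>g\<in>carrier D. act g m = m \<otimes>\<^bsub>K\<^esub> z [^]\<^bsub>K\<^esub> \<beta> g h" if "h \<in> carrier baer" for h
      using \<beta>(1)[of h] that by (simp add: W_def)
    show "subgroup N baer" by (rule N_subgroup_baer)
    show "z [^]\<^bsub>K\<^esub> \<phi> n \<in> carrier K" for n
      using zc by simp
    show "\<forall>g\<in>carrier D. act g (z [^]\<^bsub>K\<^esub> \<phi> n) = z [^]\<^bsub>K\<^esub> \<phi> n \<otimes>\<^bsub>K\<^esub> z [^]\<^bsub>K\<^esub> \<beta> g n" if "n \<in> N" for n
      using z_cong[OF additive_N[OF \<beta>(2) that]] zc by (simp add: act_z)
    show "z [^]\<^bsub>K\<^esub> \<phi> (m \<otimes>\<^bsub>baer\<^esub> n) = z [^]\<^bsub>K\<^esub> \<phi> m \<otimes>\<^bsub>K\<^esub> z [^]\<^bsub>K\<^esub> \<phi> n" if "m \<in> N" "n \<in> N" for m n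
      using that z_cong[OF \<phi>[OF that]] zc by (simp add: baer_mult_N K.M.int_pow_mult)
    fix h k m n
    assume hk: "h \<in> carrier baer" "k \<in> carrier baer" and mn: "m \<in> carrier K" "n \<in> carrier K"
      and m: "\<forall>g\<in>carrier D. act g m = m \<otimes>\<^bsub>K\<^esub> z [^]\<^bsub>K\<^esub> \<beta> g h"
      and n: "\<forall>g\<in>carrier D. act g n = n \<otimes>\<^bsub>K\<^esub> z [^]\<^bsub>K\<^esub> \<beta> g k"
    show "\<forall>g\<in>carrier D. act g (m \<otimes>\<^bsub>K\<^esub> n) = m \<otimes>\<^bsub>K\<^esub> n \<otimes>\<^bsub>K\<^esub> z [^]\<^bsub>K\<^esub> \<beta> g (h \<otimes>\<^bsub>baer\<^esub> k)"
    proof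
      fix g assume g: "g \<in> carrier D"
      \<comment> \<open>\<beta> is additive for the product of D, but the relation must respect the
        Baer product; the two differ by an element of N, where the linear form
        \<open>\<beta> g\<close> vanishes.\<close>
      have "[\<beta> g (h \<otimes>\<^bsub>baer\<^esub> k) = \<beta> g (h \<otimes> k) + \<beta> g (com k h [^] half)] (mod int p)"
        unfolding mult_baer using hk by (intro additiveD[OF \<beta>(2)[OF g]]) auto
      also have "[\<beta> g (h \<otimes> k) + \<beta> g (com k h [^] half) = (\<beta> g h + \<beta> g k) + 0] (mod int p)"
        using hk by (intro cong_add additiveD[OF \<beta>(2)[OF g]] additive_N[OF \<beta>(2)[OF g]]) auto
      finally have "z [^]\<^bsub>K\<^esub> \<beta> g (h \<otimes>\<^bsub>baer\<^esub> k) = z [^]\<^bsub>K\<^esub> (\<beta> g h + \<beta> g k)"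
        by (intro z_cong) simp
      then show "act g (m \<otimes>\<^bsub>K\<^esub> n) = m \<otimes>\<^bsub>K\<^esub> n \<otimes>\<^bsub>K\<^esub> z [^]\<^bsub>K\<^esub> \<beta> g (h \<otimes>\<^bsub>baer\<^esub> k)"
        using g m n mn zc by (simp add: K.M.int_pow_mult K.M.m_ac)
    qed
  qed
  then obtain \<psi> where \<psi>: "\<psi> \<in> hom baer K" "\<And>n. n \<in> N \<Longrightarrow> \<psi> n = z [^]\<^bsub>K\<^esub> \<phi> n"
    "\<And>g h. \<lbrakk>g \<in> carrier D; h \<in> carrier D\<rbrakk> \<Longrightarrow> act g (\<psi> h) = \<psi> h \<otimes>\<^bsub>K\<^esub> z [^]\<^bsub>K\<^esub> \<beta> g h"
    by auto
  have \<psi>_closed: "\<psi> g \<in> carrier K" if "g \<in> carrier D" for g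
    using \<psi>(1) that by (auto simp: hom_def)
  \<comment> \<open>Needed for the exponent \<open>half\<close>: it matches the value of \<phi> on a
    halved commutator with the factor \<open>half\<close> in \<open>b\<close>.\<close>
  have \<phi>_pow: "[\<phi> (n [^] k) = int k * \<phi> n] (mod int p)" if n: "n \<in> N" for n and k :: nat
  proof (induction k)
    case 0
    have "\<one> \<in> N" by (rule subgroup.one_closed[OF N_subgroup])
    from \<phi>[OF this this] show ?case by (simp add: cong_iff_dvd_diff)
  next
    case (Suc k)
    then have "[\<phi> (n [^] k) + \<phi> n = int k * \<phi> n + \<phi> n] (mod int p)"
      by (intro cong_add cong_refl)
    with \<phi>[OF N_pow[OF n] n] show ?case
      by (simp add: distrib_right add.commute) (blast intro: cong_trans)
  qed
  have \<psi>_mult: "\<psi> (g \<otimes> h) \<otimes>\<^bsub>K\<^esub> z [^]\<^bsub>K\<^esub> b g h = \<psi> g \<otimes>\<^bsub>K\<^esub> \<psi> h" if gh: "g \<in> carrier D" "h \<in> carrier D" for g h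
  proof -
    \<comment> \<open>Multiplication by an element of N is the same in both groups, so the
      correcting factor can be split off as a Baer product and \<psi> applied to it.\<close>
    have "g \<otimes>\<^bsub>baer\<^esub> h = (g \<otimes> h) \<otimes>\<^bsub>baer\<^esub> com h g [^] half"
      using gh by (simp add: baer_mult_N) (simp add: mult_baer)
    then have "\<psi> g \<otimes>\<^bsub>K\<^esub> \<psi> h = \<psi> (g \<otimes> h) \<otimes>\<^bsub>K\<^esub> \<psi> (com h g [^] half)"
      using gh hom_mult[OF \<psi>(1)] by (metis carrier_baer com_in_N N_pow N_closed m_closed)
    also have "\<psi> (com h g [^] half) = z [^]\<^bsub>K\<^esub> b g h"
      using gh z_cong[OF \<phi>_pow] by (simp add: \<psi>(2) b_def)
    finally show ?thesis by simp
  qed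
  define f where "f = (\<lambda>g\<in>carrier D. \<psi> g \<otimes>\<^bsub>K\<^esub> z [^]\<^bsub>K\<^esub> q g)"
  show ?thesis
  proof (rule that)
    show "f \<in> crossed_homs D K act"
      unfolding f_def
    proof (rule K.restrict_crossed_homI)
      fix g assume g: "g \<in> carrier D"
      then show "\<psi> g \<otimes>\<^bsub>K\<^esub> z [^]\<^bsub>K\<^esub> q g \<in> carrier K"
        using \<psi>_closed zc by simp
      fix h assume h: "h \<in> carrier D"
      have "\<psi> (g \<otimes> h) \<otimes>\<^bsub>K\<^esub> z [^]\<^bsub>K\<^esub> q (g \<otimes> h) = \<psi> (g \<otimes> h) \<otimes>\<^bsub>K\<^esub> z [^]\<^bsub>K\<^esub> (q g + q h + \<beta> g h + b g h)"
        using z_cong[OF q(1)[OF g h]] by simp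
      also have "\<dots> = (\<psi> (g \<otimes> h) \<otimes>\<^bsub>K\<^esub> z [^]\<^bsub>K\<^esub> b g h) \<otimes>\<^bsub>K\<^esub> z [^]\<^bsub>K\<^esub> (q g + q h + \<beta> g h)"
        using g h zc \<psi>_closed by (simp add: K.M.int_pow_mult K.M.m_ac)
      also have "\<dots> = \<psi> g \<otimes>\<^bsub>K\<^esub> z [^]\<^bsub>K\<^esub> q g \<otimes>\<^bsub>K\<^esub> act g (\<psi> h \<otimes>\<^bsub>K\<^esub> z [^]\<^bsub>K\<^esub> q h)"
        using g h zc \<psi>_closed by (simp add: \<psi>_mult \<psi>(3) act_z K.M.int_pow_mult K.M.m_ac)
      finally show "\<psi> (g \<otimes> h) \<otimes>\<^bsub>K\<^esub> z [^]\<^bsub>K\<^esub> q (g \<otimes> h) =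
          \<psi> g \<otimes>\<^bsub>K\<^esub> z [^]\<^bsub>K\<^esub> q g \<otimes>\<^bsub>K\<^esub> act g (\<psi> h \<otimes>\<^bsub>K\<^esub> z [^]\<^bsub>K\<^esub> q h)" .
    qed
    show "f n = z [^]\<^bsub>K\<^esub> \<phi> n" if "n \<in> N" for n
      using that zc z_cong[OF q(2)[OF that]] by (simp add: f_def \<psi>(2))
  qed
qed

subsection \<open>The Frattini subgroup\<close>

lemma (in group) subgroups_subset_set_mult:
  assumes "subgroup A G" "subgroup B G"
  shows "A \<subseteq> A <#> B" "B \<subseteq> A <#> B"
proof -
  show "A \<subseteq> A <#> B"
  proof
    fix x assume "x \<in> A"
    then have "x \<otimes> \<one> \<in> A <#> B"
      unfolding set_mult_def using subgroup.one_closed[OF assms(2)] by blast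
    then show "x \<in> A <#> B"
      using \<open>x \<in> A\<close> subgroup.mem_carrier[OF assms(1), of x] by simp
  qed
  show "B \<subseteq> A <#> B"
  proof
    fix x assume "x \<in> B"
    then have "\<one> \<otimes> x \<in> A <#> B"
      unfolding set_mult_def using subgroup.one_closed[OF assms(1)] by blast
    then show "x \<in> A <#> B"
      using \<open>x \<in> B\<close> subgroup.mem_carrier[OF assms(2), of x] by simp
  qed
qed

context class_two_group
begin

text \<open>A conjugate of h differs from h by a commutator, which lies in N and so in H.\<close>

lemma commutator_closed_imp_normal:
  assumes "subgroup H D" "N \<subseteq> H"
  shows "H \<lhd> D"
  unfolding normal_inv_iff
proof (intro conjI ballI)
  fix x h assume x: "x \<in> carrier D" and h: "h \<in> H"
  note hc = subgroup.mem_carrier[OF assms(1) h]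
  have "x \<otimes> h \<otimes> inv x = com x h \<otimes> h"
    using x hc by (simp add: com_def m_assoc)
  moreover have "com x h \<in> H"
    using x hc assms(2) by auto
  ultimately show "x \<otimes> h \<otimes> inv x \<in> H"
    using subgroup.m_closed[OF assms(1)] h by metis
qed fact

lemma N_normal: "N \<lhd> D"
  by (rule commutator_closed_imp_normal[OF N_subgroup order_refl])

text \<open>Otherwise NH = D by maximality. Central factors do not change commutators, so every
  commutator of D is already one of elements of H; this puts N into H after all.\<close>

lemma N_le_maximal_subgroup:
  assumes "maximal_subgroup H D"
  shows "N \<subseteq> H"
proof (rule ccontr)
  assume "\<not> N \<subseteq> H"
  have H: "subgroup H D" and max: "\<And>K. \<lbrakk>subgroup K D; H \<subseteq> K\<rbrakk> \<Longrightarrow> K = H \<or> K = carrier D"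
    using assms by (auto simp: maximal_subgroup_def)
  have NH: "subgroup (N <#> H) D"
    by (rule mult_norm_subgroup[OF N_normal H])
  have all: "N <#> H = carrier D"
    using max[OF NH] subgroups_subset_set_mult[OF N_subgroup H] \<open>\<not> N \<subseteq> H\<close> by blast
  have "com x y \<in> H" if xy: "x \<in> carrier D" "y \<in> carrier D" for x y
  proof -
    obtain m h n k where *: "m \<in> N" "h \<in> H" "x = m \<otimes> h" "n \<in> N" "k \<in> H" "y = n \<otimes> k"
      using xy unfolding all[symmetric] set_mult_def by blast
    have "h \<in> carrier D" "k \<in> carrier D"
      using * subgroup.mem_carrier[OF H] by auto
    then have "com x y = com h k"
      using * by (simp add: com_mult_left com_mult_right)
    moreover have "com h k \<in> H"
      unfolding com_def using * H by (simp add: subgroup.m_closed subgroup.m_inv_closed)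
    ultimately show ?thesis by simp
  qed
  then have "{x \<otimes> y \<otimes> inv x \<otimes> inv y | x y. x \<in> carrier D \<and> y \<in> carrier D} \<subseteq> H"
    unfolding com_def by blast
  then have "N \<subseteq> H"
    unfolding N_def by (rule generate_subgroup_incl[OF _ H])
  then show False
    using \<open>\<not> N \<subseteq> H\<close> by blast
qed

text \<open>Take H largest among the subgroups that contain N and avoid x. Any larger K contains x.
  If some \<open>a\<close> were outside K, then H together with the powers of \<open>a\<close> would
  contain x by the choice of H, say x = h a^k; then a^k lies in K, so p divides k and x = h lies in
  H, a contradiction.\<close>

lemma maximal_subgroup_avoiding:
  assumes x: "x \<in> carrier D" "x \<notin> N"
  shows "\<exists>H. maximal_subgroup H D \<and> x \<notin> H"
proof -
  let ?S = "{H. subgroup H D \<and> N \<subseteq> H \<and> x \<notin> H}"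
  have "?S \<subseteq> Pow (carrier D)"
    using subgroup.subset by blast
  then have "finite ?S"
    using fin finite_subset by blast
  moreover have "N \<in> ?S"
    using x N_subgroup by simp
  ultimately have "\<exists>H\<in>?S. \<forall>K\<in>?S. H \<subseteq> K \<longrightarrow> H = K"
    by (intro finite_has_maximal) auto
  then obtain H where sub: "subgroup H D" and NH: "N \<subseteq> H" and xH: "x \<notin> H"
    and max: "\<forall>K\<in>?S. H \<subseteq> K \<longrightarrow> H = K"
    by blast
  have "K = carrier D" if K: "subgroup K D" "H \<subseteq> K" "K \<noteq> H" for K
  proof
    show "carrier D \<subseteq> K"
    proof
      fix a assume a: "a \<in> carrier D"
      have xK: "x \<in> K"
        using K NH max[rule_format, of K] by auto
      show "a \<in> K"
      proof (rule ccontr)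
        assume "a \<notin> K"
        let ?P = "range (\<lambda>k::int. a [^] k)"
        have P: "subgroup ?P D"
          by (rule subgroup_of_powers[OF a])
        have HP: "subgroup (H <#> ?P) D"
          by (rule mult_norm_subgroup[OF commutator_closed_imp_normal[OF sub NH] P])
        have "a \<in> ?P"
          using a by (intro range_eqI[of _ _ "1::int"]) simp
        then have "a \<in> H <#> ?P"
          using subgroups_subset_set_mult(2)[OF sub P] by blast
        with subgroups_subset_set_mult(1)[OF sub P] have "x \<in> H <#> ?P"
          using max[rule_format, of "H <#> ?P"] HP NH \<open>a \<notin> K\<close> K(2) by auto
        then obtain h and k :: int where hk: "h \<in> H" "x = h \<otimes> a [^] k"
          by (auto simp: set_mult_def)
        note hc = subgroup.mem_carrier[OF sub hk(1)]
        have "a [^] k = inv h \<otimes> x"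
          using hk a hc x by (simp add: inv_solve_left)
        also have "\<dots> \<in> K"
          using hk K xK by (auto intro: subgroup.m_closed subgroup.m_inv_closed)
        finally have "int p dvd k"
          using int_pow_mem_subgroup_imp_dvd[OF p(1) a exponent[OF a] K(1) \<open>a \<notin> K\<close>] by blast
        then have "a [^] k = a [^] (0::int)"
          by (intro int_pow_exponent_cong[OF a exponent[OF a]]) (simp add: cong_0_iff)
        then show False
          using hk hc xH by simp
      qed
    qed
  qed (use K subgroup.subset in blast)
  then show ?thesis
    using sub xH x by (auto simp: maximal_subgroup_def)
qed

lemma frattini_eq: "frattini D = N"
  using N_le_maximal_subgroup maximal_subgroup_avoiding N_closed
  unfolding frattini_def by blast

end

subsection \<open>Splitting of the first cohomology\<close>

context class_two_group
begin

text \<open>The splitting is made on cocycles, where inflation is injective and exponent p is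
  visible pointwise. Coboundaries are divided out at the end; they vanish on N and hence affect only
  the inflated factor.\<close>

lemma H1_splits:
  fixes K :: "('m, 'e) monoid_scheme"
  assumes CR: "CR_module p (D Mod N) K actQ" and card_N: "card N = p ^ n"
  shows "H1 D K (\<lambda>g. actQ (N #> g)) \<cong> H1 (D Mod N) K actQ \<times>\<times> Fp_power p n"
proof -
  have p0: "p > 0" "p > 1"
    using p prime_gt_0_nat prime_gt_1_nat by auto
  have module: "Fp_module p (D Mod N) K actQ"
    using CR by (simp add: CR_module_def)
  interpret normal N D by (rule N_normal)
  interpret Q: fp_module "D Mod N" K p actQ
    by (rule fp_moduleI[OF module])
  interpret I: inflated_module N D K p actQ
    by unfold_locales
  interpret F: comm_group "Fp_power p n"
    by (rule comm_group_Fp_power)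
  let ?act = "\<lambda>g. actQ (N #> g)" and ?inf = "inflate D N"
  let ?X = "crossed_homs D K ?act" and ?Y = "crossed_homs (D Mod N) K actQ"
  have p_iso: "K\<lparr>carrier := fixed_points (D Mod N) K actQ\<rparr> \<cong> integer_mod_group p"
    using CR by (simp add: CR_module_def)
  have fixed: "fixed_points (D Mod N) K actQ = fixed_points D K ?act"
    by (auto simp: fixed_points_def carrier_FactGroup)
  obtain z lg where z: "z \<in> fixed_points D K ?act"
    and "\<forall>x\<in>fixed_points D K ?act. 0 \<le> lg x \<and> lg x < int p \<and> x = z [^]\<^bsub>K\<^esub> lg x"
    and "\<forall>k::int. lg (z [^]\<^bsub>K\<^esub> k) = k mod int p"
    and "\<forall>x\<in>fixed_points D K ?act. \<forall>y\<in>fixed_points D K ?act. lg (x \<otimes>\<^bsub>K\<^esub> y) = (lg x + lg y) mod int p"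
    using Q.fixed_points_generator[OF p0(2) p_iso] unfolding fixed by (elim exE conjE) (rule that)
  note lg = this(2)[rule_format] and lg_pow = this(3)[rule_format] and lg_mult = this(4)[rule_format]
  have zc: "z \<in> carrier K" and z_fix: "\<And>g. g \<in> carrier D \<Longrightarrow> ?act g z = z"
    using z by (auto simp: fixed_points_def)
  have z_cong: "z [^]\<^bsub>K\<^esub> k = z [^]\<^bsub>K\<^esub> l" if "[k = l] (mod int p)" for k l :: int
    by (rule Q.M.int_pow_exponent_cong[OF zc Q.M_exponent[OF zc] that])
  \<comment> \<open>The crossed homomorphism with values in the fixed points that belongs to a
    linear form k; whether it is a coboundary decides whether k lies in the subspace W.\<close>
  define Pz where "Pz k = (\<lambda>g\<in>carrier D. z [^]\<^bsub>K\<^esub> (k g :: int))" for k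
  have Pz: "\<exists>u\<in>?Y. Pz k = ?inf u" if k: "additive k" for k
  proof -
    have "Pz k \<in> ?X"
      unfolding Pz_def
    proof (rule I.P.restrict_crossed_homI)
      fix g h assume gh: "g \<in> carrier D" "h \<in> carrier D"
      have "z [^]\<^bsub>K\<^esub> k (g \<otimes> h) = z [^]\<^bsub>K\<^esub> k g \<otimes>\<^bsub>K\<^esub> z [^]\<^bsub>K\<^esub> k h"
        using z_cong[OF additiveD[OF k gh]] zc by (simp add: Q.M.int_pow_mult)
      then show "z [^]\<^bsub>K\<^esub> k (g \<otimes> h) = z [^]\<^bsub>K\<^esub> k g \<otimes>\<^bsub>K\<^esub> ?act g (z [^]\<^bsub>K\<^esub> k h)"
        using gh zc z_fix by (simp add: I.P.act_int_pow)
    qed (use zc in simp)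
    moreover have "Pz k m = \<one>\<^bsub>K\<^esub>" if "m \<in> N" for m
      using z_cong[OF additive_N[OF k that]] that by (simp add: Pz_def)
    ultimately show ?thesis
      using I.inflate_onto by blast
  qed
  have Pz_B1: "Pz k \<in> I.P.B1 \<longleftrightarrow> (\<exists>m\<in>carrier K. \<forall>g\<in>carrier D. ?act g m = m \<otimes>\<^bsub>K\<^esub> z [^]\<^bsub>K\<^esub> k g)" for k
  proof -
    have "Pz k = (\<lambda>g\<in>carrier D. ?act g m \<otimes>\<^bsub>K\<^esub> inv\<^bsub>K\<^esub> m) \<longleftrightarrow>
        (\<forall>g\<in>carrier D. ?act g m = m \<otimes>\<^bsub>K\<^esub> z [^]\<^bsub>K\<^esub> k g)" if m: "m \<in> carrier K" for m
    proof -
      have "z [^]\<^bsub>K\<^esub> k g = ?act g m \<otimes>\<^bsub>K\<^esub> inv\<^bsub>K\<^esub> m \<longleftrightarrow> ?act g m = m \<otimes>\<^bsub>K\<^esub> z [^]\<^bsub>K\<^esub> k g"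
        if "g \<in> carrier D" for g
        using m that zc Q.M.inv_solve_right[of "z [^]\<^bsub>K\<^esub> k g" "?act g m" m]
        by (simp add: Q.M.m_comm eq_commute)
      then show ?thesis
        unfolding Pz_def by (auto simp: fun_eq_iff)
    qed
    then show ?thesis
      by (auto simp: principal_crossed_homs_def)
  qed
  have codim: "\<exists>t::int. \<exists>m\<in>carrier K. \<forall>g\<in>carrier D. ?act g m = m \<otimes>\<^bsub>K\<^esub> z [^]\<^bsub>K\<^esub> (\<chi> g - t * \<mu> g)"
    if \<chi>: "additive \<chi>" and \<mu>: "additive \<mu>"
      and not: "\<not> (\<exists>m\<in>carrier K. \<forall>g\<in>carrier D. ?act g m = m \<otimes>\<^bsub>K\<^esub> z [^]\<^bsub>K\<^esub> \<mu> g)" for \<chi> \<mu>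
  proof -
    obtain u v where u: "u \<in> ?Y" "Pz \<chi> = ?inf u" and v: "v \<in> ?Y" "Pz \<mu> = ?inf v"
      using Pz \<chi> \<mu> by metis
    have "v \<notin> Q.B1"
      using not v I.inflate_in_B1_iff unfolding Pz_B1[symmetric] by metis
    moreover have "finite (rcosets\<^bsub>Q.Z1\<^esub> Q.B1)" "card (rcosets\<^bsub>Q.Z1\<^esub> Q.B1) \<le> p"
      using CR by (simp_all add: CR_module_def Q.H1_carrier)
    ultimately obtain t :: int where t: "u \<otimes>\<^bsub>Q.Z1\<^esub> v [^]\<^bsub>Q.Z1\<^esub> t \<in> Q.B1"
      using Q.Z1.subgroup_index_le_prime[OF p(1) Q.B1_subgroup, of v u] u v Q.Z1_exponent by auto
    have cl: "u \<otimes>\<^bsub>Q.Z1\<^esub> v [^]\<^bsub>Q.Z1\<^esub> t \<in> ?Y"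
      using u v Q.Z1.m_closed Q.Z1.int_pow_closed by simp
    \<comment> \<open>The index bound gives u + t v in additive notation, while the claim is phrased
      with a difference; hence the double minus sign.\<close>
    have "?inf (u \<otimes>\<^bsub>Q.Z1\<^esub> v [^]\<^bsub>Q.Z1\<^esub> t) = Pz (\<lambda>g. \<chi> g - - t * \<mu> g)"
    proof (rule I.P.crossed_hom_eqI[OF I.inflate_closed[OF cl]])
      have add: "additive (\<lambda>g. \<chi> g - - t * \<mu> g)"
        unfolding additive_def
      proof (intro ballI)
        fix g h assume gh: "g \<in> carrier D" "h \<in> carrier D"
        have "[\<chi> (g \<otimes> h) - - t * \<mu> (g \<otimes> h) = (\<chi> g + \<chi> h) - - t * (\<mu> g + \<mu> h)] (mod int p)"
          by (intro cong_diff cong_mult cong_refl additiveD[OF \<chi> gh] additiveD[OF \<mu> gh])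
        then show "[\<chi> (g \<otimes> h) - - t * \<mu> (g \<otimes> h) = \<chi> g - - t * \<mu> g + (\<chi> h - - t * \<mu> h)] (mod int p)"
          by (simp add: algebra_simps)
      qed
      show "Pz (\<lambda>g. \<chi> g - - t * \<mu> g) \<in> ?X"
        using Pz[OF add] I.inflate_closed by auto
      fix g assume g: "g \<in> carrier D"
      have "u (N #> g) = z [^]\<^bsub>K\<^esub> \<chi> g" "v (N #> g) = z [^]\<^bsub>K\<^esub> \<mu> g"
        using fun_cong[OF u(2), of g] fun_cong[OF v(2), of g] g by (simp_all add: Pz_def)
      then show "?inf (u \<otimes>\<^bsub>Q.Z1\<^esub> v [^]\<^bsub>Q.Z1\<^esub> t) g = Pz (\<lambda>g. \<chi> g - - t * \<mu> g) g"
        using g v zc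
        by (simp add: Pz_def Q.mult_Z1 Q.Z1_int_pow_apply Q.M.int_pow_pow Q.M.int_pow_mult mult.commute)
    qed
    then have "Pz (\<lambda>g. \<chi> g - - t * \<mu> g) \<in> I.P.B1"
      using t I.inflate_in_B1_iff[OF cl] by simp
    then show ?thesis
      unfolding Pz_B1 by blast
  qed

  let ?DN = "D\<lparr>carrier := N\<rparr>"
  have DN: "comm_group ?DN"
    using N_subgroup by (intro group.group_comm_groupI subgroup_imp_group) (auto simp: central)
  have "\<exists>\<iota>. \<iota> \<in> iso (Fp_power p n) ?DN"
  proof (rule elementary_abelian_iso_Fp_power[OF p(1) DN])
    show "x [^]\<^bsub>?DN\<^esub> p = \<one>\<^bsub>?DN\<^esub>" if "x \<in> carrier ?DN" for x
      using that exponent[of x] nat_pow_consistent[of x p N] by simp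
  qed (simp add: order_def card_N)
  then obtain \<iota> where \<iota>: "\<iota> \<in> iso (Fp_power p n) ?DN" by blast
  then have \<iota>_hom: "\<iota> \<in> hom (Fp_power p n) ?DN" and \<iota>_bij: "bij_betw \<iota> (carrier (Fp_power p n)) N"
    by (auto simp: iso_def)
  define \<tau> where "\<tau> = inv_into (carrier (Fp_power p n)) \<iota>"
  have \<tau>: "\<tau> \<in> hom ?DN (Fp_power p n)"
    using F.iso_set_sym[OF \<iota>] by (simp add: \<tau>_def iso_def)
  define e :: "nat \<Rightarrow> nat \<Rightarrow> int" where "e i = (\<lambda>j\<in>{..<n}. if j = i then 1 else 0)" for i
  have e: "e i \<in> carrier (Fp_power p n)" for i
    using p0 by (auto simp: e_def carrier_Fp_power)
  have \<iota>_N: "\<iota> v \<in> N" if "v \<in> carrier (Fp_power p n)" for v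
    using \<iota>_hom that by (auto simp: hom_def)
  have \<tau>_\<iota>: "\<tau> (\<iota> v) = v" if "v \<in> carrier (Fp_power p n)" for v
    unfolding \<tau>_def using \<iota>_bij that by (intro inv_into_f_f) (auto simp: bij_betw_def)
  \<comment> \<open>Restriction to N in coordinates: a homomorphism from N to the powers of z is
    recorded by its logarithms on the basis \<open>\<iota> (e i)\<close>.\<close>
  define \<rho> where "\<rho> f = (\<lambda>i\<in>{..<n}. lg (f (\<iota> (e i))))" for f
  \<comment> \<open>Expand f(gm) = f(mg) in both ways: m is central and acts trivially, so comparing
    the results leaves g f(m) = f(m).\<close>
  have f_N: "f m \<in> fixed_points D K ?act" if f: "f \<in> ?X" and m: "m \<in> N" for f m
    unfolding fixed_points_def
  proof (clarsimp, intro conjI ballI)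
    show "f m \<in> carrier K" using f m by simp
    fix g assume g: "g \<in> carrier D"
    have "f g \<otimes>\<^bsub>K\<^esub> ?act g (f m) = f m \<otimes>\<^bsub>K\<^esub> ?act m (f g)"
      using I.P.crossed_hom_mult[OF f g, of m] I.P.crossed_hom_mult[OF f _ g, of m] m central[OF m g]
      by simp
    also have "\<dots> = f g \<otimes>\<^bsub>K\<^esub> f m"
      using f g m by (simp add: I.N_acts_trivially Q.M.m_comm)
    finally show "?act g (f m) = f m"
      using f g m by (simp del: I.coset_mult)
  qed
  have \<rho>_hom: "\<rho> \<in> hom I.P.Z1 (Fp_power p n)"
  proof (rule homI)
    fix f f' assume "f \<in> carrier I.P.Z1" "f' \<in> carrier I.P.Z1"
    then show "\<rho> (f \<otimes>\<^bsub>I.P.Z1\<^esub> f') = \<rho> f \<otimes>\<^bsub>Fp_power p n\<^esub> \<rho> f'"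
      unfolding \<rho>_def mult_Fp_power
      by (intro restrict_ext) (simp add: I.P.mult_Z1 \<iota>_N e lg_mult f_N)
  qed (use lg f_N \<iota>_N e p0 in \<open>auto simp: \<rho>_def carrier_Fp_power\<close>)
  interpret \<rho>: group_hom I.P.Z1 "Fp_power p n" \<rho>
    using \<rho>_hom by unfold_locales
  have \<rho>_ker: "f \<in> ?inf ` ?Y" if f: "f \<in> ?X" and \<rho>f: "\<rho> f = \<one>\<^bsub>Fp_power p n\<^esub>" for f
  proof (rule I.inflate_onto[OF f])
    fix m assume m: "m \<in> N"
    then obtain v where v: "v \<in> carrier (Fp_power p n)" "m = \<iota> v"
      using \<iota>_bij by (auto simp: bij_betw_def)
    have "(f \<circ> \<iota>) v = \<one>\<^bsub>K\<^esub>"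
    proof (rule hom_Fp_power_eq_oneI[OF p0(2) Q.M.is_group _ _ v(1)])
      show "f \<circ> \<iota> \<in> hom (Fp_power p n) K"
      proof (rule homI)
        fix v w assume vw: "v \<in> carrier (Fp_power p n)" "w \<in> carrier (Fp_power p n)"
        then show "(f \<circ> \<iota>) v \<in> carrier K"
          using f \<iota>_N by simp
        show "(f \<circ> \<iota>) (v \<otimes>\<^bsub>Fp_power p n\<^esub> w) = (f \<circ> \<iota>) v \<otimes>\<^bsub>K\<^esub> (f \<circ> \<iota>) w"
          using hom_mult[OF \<iota>_hom vw] vw f \<iota>_N I.P.crossed_hom_mult[OF f, of "\<iota> v" "\<iota> w"]
          by (simp add: I.N_acts_trivially)
      qed
      fix i assume i: "i < n"
      have "lg (f (\<iota> (e i))) = 0"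
        using fun_cong[OF \<rho>f, of i] i by (simp add: \<rho>_def one_Fp_power)
      then have "f (\<iota> (e i)) = \<one>\<^bsub>K\<^esub>"
        using lg[OF f_N[OF f \<iota>_N[OF e]], of i] by simp
      then show "(f \<circ> \<iota>) (\<lambda>j\<in>{..<n}. if j = i then 1 else 0) = \<one>\<^bsub>K\<^esub>"
        by (simp add: e_def)
    qed
    then show "f m = \<one>\<^bsub>K\<^esub>"
      by (simp add: v)
  qed
  have \<rho>_inf: "\<rho> (?inf u) = \<one>\<^bsub>Fp_power p n\<^esub>" if u: "u \<in> ?Y" for u
    unfolding \<rho>_def one_Fp_power
  proof (rule restrict_ext)
    fix i
    have "u \<one>\<^bsub>D Mod N\<^esub> = u \<one>\<^bsub>D Mod N\<^esub> \<otimes>\<^bsub>K\<^esub> u \<one>\<^bsub>D Mod N\<^esub>"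
      using Q.crossed_hom_mult[OF u Q.L.one_closed Q.L.one_closed] u Q.L.one_closed Q.L.l_one[OF Q.L.one_closed]
      by (simp del: one_FactGroup mult_FactGroup)
    then have "u \<one>\<^bsub>D Mod N\<^esub> = \<one>\<^bsub>K\<^esub>"
      using Q.crossed_hom_closed[OF u Q.L.one_closed] by (metis Q.M.r_cancel_one')
    then have "u (N #> \<iota> (e i)) = \<one>\<^bsub>K\<^esub>"
      using I.coset_N[OF \<iota>_N[OF e], of i] by (simp only:)
    then show "lg (?inf u (\<iota> (e i))) = 0"
      using lg_pow[of 0] \<iota>_N[OF e, of i] by simp
  qed
  have \<rho>_onto: "\<exists>f\<in>?X. \<rho> f = v" if v: "v \<in> carrier (Fp_power p n)" for v
  proof -
    \<comment> \<open>The linear functional on N with coordinate vector v in the dual basis.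
      Coordinates are reduced residues, so the integer sum is additive only modulo p, which is all
      the extension asks for.\<close>
    define \<phi> where "\<phi> x = (\<Sum>i<n. v i * \<tau> x i)" for x
    have \<phi>: "[\<phi> (x \<otimes> y) = \<phi> x + \<phi> y] (mod int p)" if "x \<in> N" "y \<in> N" for x y
    proof -
      have "\<tau> (x \<otimes> y) = \<tau> x \<otimes>\<^bsub>Fp_power p n\<^esub> \<tau> y"
        using hom_mult[OF \<tau>, of x y] that by simp
      then have "[\<phi> (x \<otimes> y) = (\<Sum>i<n. v i * (\<tau> x i + \<tau> y i))] (mod int p)"
        unfolding \<phi>_def by (intro cong_sum cong_mult cong_refl) (simp add: mult_Fp_power)
      then show ?thesis
        by (simp add: \<phi>_def sum.distrib distrib_left)
    qed
    obtain f where f: "f \<in> ?X" "\<And>x. x \<in> N \<Longrightarrow> f x = z [^]\<^bsub>K\<^esub> \<phi> x"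
      using extend_to_crossed_hom[OF I.Fp_module_pullback I.N_acts_trivially z codim \<phi>] by blast
    have "\<rho> f = v"
    proof (rule PiE_ext)
      show "\<rho> f \<in> (\<Pi>\<^sub>E i\<in>{..<n}. {0..<int p})" "v \<in> (\<Pi>\<^sub>E i\<in>{..<n}. {0..<int p})"
        using \<rho>.hom_closed[of f] f v p0 by (simp_all add: carrier_Fp_power)
      fix i assume i: "i \<in> {..<n}"
      have "\<phi> (\<iota> (e i)) = v i"
      proof -
        have "\<phi> (\<iota> (e i)) = (\<Sum>j<n. if j = i then v j else 0)"
          unfolding \<phi>_def \<tau>_\<iota>[OF e] by (rule sum.cong) (auto simp: e_def)
        then show ?thesis using i by simp
      qed
      moreover have "v i mod int p = v i"
        using v i p0 by (auto simp: carrier_Fp_power PiE_iff)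
      ultimately show "\<rho> f i = v i"
        using i f(2)[OF \<iota>_N[OF e]] by (simp add: \<rho>_def lg_pow)
    qed
    then show ?thesis
      using f by blast
  qed
  \<comment> \<open>A homomorphic section of \<rho>: the relation is \<open>\<rho> f = v\<close>,
    total because \<rho> is onto, and the extension starts from the trivial subgroup.\<close>
  have "\<exists>S\<in>hom (Fp_power p n) I.P.Z1. (\<forall>v\<in>{\<one>\<^bsub>Fp_power p n\<^esub>}. S v = \<one>\<^bsub>I.P.Z1\<^esub>) \<and>
      (\<forall>v\<in>carrier (Fp_power p n). \<rho> (S v) = v)"
  proof (rule hom_extension_within_relation[OF p(1) comm_group_Fp_power finite_Fp_power[OF p0(1)]
        Fp_power_exponent I.P.Z1_comm_group I.P.Z1_exponent])
    show "subgroup {\<one>\<^bsub>Fp_power p n\<^esub>} (Fp_power p n)"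
      by (rule F.triv_subgroup)
  qed (use \<rho>_onto I.P.Z1.one_closed in auto)
  then obtain S where S: "S \<in> hom (Fp_power p n) I.P.Z1"
    and \<rho>_S: "\<And>v. v \<in> carrier (Fp_power p n) \<Longrightarrow> \<rho> (S v) = v" by blast

  have H1_hom: "(\<lambda>u. Q.B1 #>\<^bsub>Q.Z1\<^esub> u) \<in> hom Q.Z1 (H1 (D Mod N) K actQ)"
    unfolding H1_def using Q.Z1.normal_iff_subgroup Q.B1_subgroup normal.r_coset_hom_Mod by blast
  let ?T = "\<lambda>(u, v). ?inf u \<otimes>\<^bsub>I.P.Z1\<^esub> S v"
  have ZF: "group (Q.Z1 \<times>\<times> Fp_power p n)"
    by (rule DirProd_group[OF Q.Z1.is_group F.is_group])
  interpret inf: group_hom Q.Z1 I.P.Z1 ?inf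
    using I.inflate_hom by unfold_locales
  interpret S: group_hom "Fp_power p n" I.P.Z1 S
    using S by unfold_locales
  have "?T \<in> hom (Q.Z1 \<times>\<times> Fp_power p n) I.P.Z1"
    by (rule homI) (auto simp: I.P.Z1.m_ac simp del: Q.carrier_Z1 I.P.carrier_Z1)
  then interpret T: group_hom "Q.Z1 \<times>\<times> Fp_power p n" I.P.Z1 ?T
    using ZF by (intro group_hom.intro group_hom_axioms.intro) auto
  have \<rho>_T: "\<rho> (?T (u, v)) = v" if "u \<in> ?Y" "v \<in> carrier (Fp_power p n)" for u v
    using that \<rho>.hom_mult[of "?inf u" "S v"] inf.hom_closed[of u] S.hom_closed[of v]
    by (simp add: \<rho>_inf \<rho>_S)
  have T_iso: "?T \<in> iso (Q.Z1 \<times>\<times> Fp_power p n) I.P.Z1"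
    unfolding T.iso_iff
  proof (intro conjI subsetI ballI impI)
    fix f assume f: "f \<in> carrier I.P.Z1"
    \<comment> \<open>Dividing by the section value removes the restriction to N, so what remains is
      inflated.\<close>
    let ?f = "f \<otimes>\<^bsub>I.P.Z1\<^esub> inv\<^bsub>I.P.Z1\<^esub> S (\<rho> f)"
    have "\<rho> ?f = \<rho> f \<otimes>\<^bsub>Fp_power p n\<^esub> inv\<^bsub>Fp_power p n\<^esub> \<rho> f"
      using f \<rho>_S[OF \<rho>.hom_closed[OF f]] by (simp del: I.P.carrier_Z1)
    then have "\<rho> ?f = \<one>\<^bsub>Fp_power p n\<^esub>"
      using f by (simp del: I.P.carrier_Z1)
    moreover have "?f \<in> carrier I.P.Z1"
      using f by (simp del: I.P.carrier_Z1)
    ultimately obtain u where u: "u \<in> ?Y" "?f = ?inf u"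
      using \<rho>_ker by auto
    have "f = ?T (u, \<rho> f)"
      using f by (simp add: u(2)[symmetric] I.P.Z1.m_assoc del: I.P.carrier_Z1)
    then show "f \<in> ?T ` carrier (Q.Z1 \<times>\<times> Fp_power p n)"
      using u f \<rho>.hom_closed by (intro image_eqI[of _ _ "(u, \<rho> f)"]) auto
  next
    fix w assume "w \<in> carrier (Q.Z1 \<times>\<times> Fp_power p n)" and T1: "?T w = \<one>\<^bsub>I.P.Z1\<^esub>"
    then obtain u v where w: "w = (u, v)" "u \<in> ?Y" "v \<in> carrier (Fp_power p n)" by auto
    have v1: "v = \<one>\<^bsub>Fp_power p n\<^esub>"
      using \<rho>_T[OF w(2,3)] T1 w by simp
    then have "?inf u = \<one>\<^bsub>I.P.Z1\<^esub>"
      using T1 w inf.hom_closed[of u] by (simp del: I.P.carrier_Z1)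
    then have "?inf u = ?inf \<one>\<^bsub>Q.Z1\<^esub>" by simp
    then have "u = \<one>\<^bsub>Q.Z1\<^esub>"
      using inj_onD[OF I.inflate_inj] w Q.Z1.one_closed by auto
    then show "w = \<one>\<^bsub>Q.Z1 \<times>\<times> Fp_power p n\<^esub>"
      by (simp add: w v1)
  qed
  define T' where "T' = inv_into (carrier (Q.Z1 \<times>\<times> Fp_power p n)) ?T"
  have T': "T' \<in> iso I.P.Z1 (Q.Z1 \<times>\<times> Fp_power p n)"
    unfolding T'_def by (rule group.iso_set_sym[OF ZF T_iso])
  have T'_T: "T' (?T w) = w" if "w \<in> carrier (Q.Z1 \<times>\<times> Fp_power p n)" for w
    unfolding T'_def using T_iso that by (intro inv_into_f_f) (auto simp: iso_def bij_betw_def)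
  \<comment> \<open>Undo \<open>?T\<close> and pass to cohomology in the first factor only. The
    result follows from the first isomorphism theorem once the kernel is seen to be the group of
    coboundaries over D.\<close>
  let ?\<Phi> = "(\<lambda>(u, v). (Q.B1 #>\<^bsub>Q.Z1\<^esub> u, v)) \<circ> T'"
  have "(\<lambda>(u, v). (Q.B1 #>\<^bsub>Q.Z1\<^esub> u, v)) \<in> hom (Q.Z1 \<times>\<times> Fp_power p n) (H1 (D Mod N) K actQ \<times>\<times> Fp_power p n)"
    using H1_hom by (auto simp: hom_def Pi_iff)
  then have \<Phi>_hom: "?\<Phi> \<in> hom I.P.Z1 (H1 (D Mod N) K actQ \<times>\<times> Fp_power p n)"
    using T' by (intro Group.hom_compose) (auto simp: iso_def)
  have H1_group: "group (H1 (D Mod N) K actQ)"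
    unfolding H1_def using Q.Z1.normal_iff_subgroup Q.B1_subgroup normal.factorgroup_is_group by blast
  interpret \<Phi>: group_hom I.P.Z1 "H1 (D Mod N) K actQ \<times>\<times> Fp_power p n" ?\<Phi>
    using \<Phi>_hom DirProd_group[OF H1_group F.is_group] by (intro group_hom.intro group_hom_axioms.intro) auto
  have onto: "?\<Phi> ` carrier I.P.Z1 = carrier (H1 (D Mod N) K actQ \<times>\<times> Fp_power p n)"
  proof -
    have "T' ` carrier I.P.Z1 = carrier (Q.Z1 \<times>\<times> Fp_power p n)"
      using T' by (auto simp: iso_def bij_betw_def)
    then show ?thesis
      unfolding image_comp[symmetric]
      by (force simp: Q.H1_carrier RCOSETS_def)
  qed
  have ker: "kernel I.P.Z1 (H1 (D Mod N) K actQ \<times>\<times> Fp_power p n) ?\<Phi> = I.P.B1"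
  proof -
    have "?\<Phi> f = \<one>\<^bsub>H1 (D Mod N) K actQ \<times>\<times> Fp_power p n\<^esub> \<longleftrightarrow> f \<in> I.P.B1" if f: "f \<in> carrier I.P.Z1" for f
    proof -
      obtain u v where w: "u \<in> ?Y" "v \<in> carrier (Fp_power p n)" "f = ?T (u, v)"
      proof -
        have "f \<in> ?T ` carrier (Q.Z1 \<times>\<times> Fp_power p n)"
          using f T_iso by (simp add: iso_def bij_betw_def del: carrier_DirProd)
        then show ?thesis
          using that by auto
      qed
      have "\<one>\<^bsub>H1 (D Mod N) K actQ\<^esub> = Q.B1"
        by (simp add: H1_def)
      then have "?\<Phi> f = \<one>\<^bsub>H1 (D Mod N) K actQ \<times>\<times> Fp_power p n\<^esub> \<longleftrightarrow> Q.B1 #>\<^bsub>Q.Z1\<^esub> u = Q.B1 \<and> v = \<one>\<^bsub>Fp_power p n\<^esub>"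
        using w T'_T[of "(u, v)"] by simp
      also have "\<dots> \<longleftrightarrow> u \<in> Q.B1 \<and> v = \<one>\<^bsub>Fp_power p n\<^esub>"
        using w Q.Z1.coset_join1[OF _ _ Q.B1_subgroup] Q.Z1.coset_join2[OF _ Q.B1_subgroup]
          subgroup.subset[OF Q.B1_subgroup] by auto
      also have "\<dots> \<longleftrightarrow> f \<in> I.P.B1"
      proof
        assume "u \<in> Q.B1 \<and> v = \<one>\<^bsub>Fp_power p n\<^esub>"
        then show "f \<in> I.P.B1"
          using w inf.hom_closed[of u] I.inflate_in_B1_iff by (simp del: I.P.carrier_Z1)
      next
        \<comment> \<open>N acts trivially, so a coboundary is trivial on N; its second component is
          therefore 1, and it is inflated.\<close>
        assume fB: "f \<in> I.P.B1"
        then obtain m where m: "m \<in> carrier K" "f = (\<lambda>g\<in>carrier D. ?act g m \<otimes>\<^bsub>K\<^esub> inv\<^bsub>K\<^esub> m)"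
          by (auto simp: principal_crossed_homs_def)
        have "\<rho> f = \<one>\<^bsub>Fp_power p n\<^esub>"
          unfolding \<rho>_def one_Fp_power
          using m lg_pow[of 0] \<iota>_N[OF e] by (intro restrict_ext) (simp add: I.N_acts_trivially)
        then have v1: "v = \<one>\<^bsub>Fp_power p n\<^esub>"
          using \<rho>_T w by simp
        then have "f = ?inf u"
          using w inf.hom_closed[of u] by (simp del: I.P.carrier_Z1)
        then show "u \<in> Q.B1 \<and> v = \<one>\<^bsub>Fp_power p n\<^esub>"
          using fB v1 I.inflate_in_B1_iff[OF w(1)] by simp
      qed
      finally show ?thesis .
    qed
    then show ?thesis
      using subgroup.subset[OF I.P.B1_subgroup] unfolding kernel_def by blast
  qed
  have "(\<lambda>C. the_elem (?\<Phi> ` C)) \<in> iso (H1 D K ?act) (H1 (D Mod N) K actQ \<times>\<times> Fp_power p n)"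
    using \<Phi>.FactGroup_iso_set[OF onto] unfolding ker by (simp only: H1_def)
  then show ?thesis
    by (rule is_isoI)
qed

end

theorem theorem3p9:
  fixes p d :: nat and D :: "'g monoid" and K :: "'m monoid"
    and actQ :: "'g set \<Rightarrow> 'm \<Rightarrow> 'm"
  assumes p: "Factorial_Ring.prime p" "odd p"
    and d: "d \<ge> 2"
    and D_group: "group D" "finite (carrier D)"
    and D_pgroup: "\<exists>n. order D = p ^ n"
    and D_gen: "\<exists>y :: nat \<Rightarrow> 'g. y ` {..<d} \<subseteq> carrier D \<and> generate D (y ` {..<d}) = carrier D"
    and D_exp: "\<forall>x\<in>carrier D. x [^]\<^bsub>D\<^esub> p = \<one>\<^bsub>D\<^esub>"
    and D_class2: "lower_central D 3 = {\<one>\<^bsub>D\<^esub>}" "lower_central D 2 \<noteq> {\<one>\<^bsub>D\<^esub>}"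
    and D_frat: "order (D Mod frattini D) = p ^ d"
    and D_frat2: "order ((D\<lparr>carrier := frattini D\<rparr>) Mod lower_central D 3) = p ^ (d choose 2)"
    and K: "CR_module p (D Mod frattini D) K actQ"
  shows "H1 D K (\<lambda>g. actQ (frattini D #>\<^bsub>D\<^esub> g))
           \<cong> H1 (D Mod frattini D) K actQ \<times>\<times> Fp_power p (d choose 2)"
proof -
  interpret D: group D by fact
  let ?N = "lower_central D 2"
  have N_def: "?N = generate D {x \<otimes>\<^bsub>D\<^esub> y \<otimes>\<^bsub>D\<^esub> inv\<^bsub>D\<^esub> x \<otimes>\<^bsub>D\<^esub> inv\<^bsub>D\<^esub> y | x y. x \<in> carrier D \<and> y \<in> carrier D}"
    by (simp add: numeral_2_eq_2 commutator_subgroup_def)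
  have gamma3: "lower_central D 3 = commutator_subgroup D ?N (carrier D)"
    by (simp add: numeral_2_eq_2 numeral_3_eq_3)
  have N_sub: "?N \<subseteq> carrier D"
    unfolding N_def by (rule D.generate_incl) auto
  \<comment> \<open>The derived subgroup is used for N because its generators are explicit;
    \<open>frattini_eq\<close> then identifies it with the Frattini subgroup of the statement. Its
    centrality is the triviality of gamma_3.\<close>
  interpret class_two_group D ?N p
  proof
    fix n x assume n: "n \<in> ?N" and x: "x \<in> carrier D"
    note nc = subsetD[OF N_sub n]
    have "n \<otimes>\<^bsub>D\<^esub> x \<otimes>\<^bsub>D\<^esub> inv\<^bsub>D\<^esub> n \<otimes>\<^bsub>D\<^esub> inv\<^bsub>D\<^esub> x \<in> lower_central D 3"
      unfolding gamma3 commutator_subgroup_def using n x by (intro generate.incl) auto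
    then have "n \<otimes>\<^bsub>D\<^esub> x \<otimes>\<^bsub>D\<^esub> inv\<^bsub>D\<^esub> (x \<otimes>\<^bsub>D\<^esub> n) = \<one>\<^bsub>D\<^esub>"
      using n x nc D_class2(1) by (simp add: D.inv_mult_group D.m_assoc)
    then show "n \<otimes>\<^bsub>D\<^esub> x = x \<otimes>\<^bsub>D\<^esub> n"
      using x nc by (metis D.inv_equality D.inv_inv D.inv_closed D.m_closed)
  qed (use p D_group D_exp N_def in auto)
  \<comment> \<open>Since gamma_3 is trivial, the cosets in the second layer are singletons, and the
    given order of that layer is the order of N itself.\<close>
  have "order ((D\<lparr>carrier := ?N\<rparr>) Mod {\<one>\<^bsub>D\<^esub>}) = card ?N"
  proof -
    have "carrier ((D\<lparr>carrier := ?N\<rparr>) Mod {\<one>\<^bsub>D\<^esub>}) = (\<lambda>x. {x}) ` ?N"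
      by (auto simp: carrier_FactGroup r_coset_def)
    then show ?thesis
      by (simp add: order_def card_image)
  qed
  then have "card ?N = p ^ (d choose 2)"
    using D_frat2 by (simp add: frattini_eq D_class2(1))
  then show ?thesis
    using H1_splits[of K actQ] K by (simp add: frattini_eq)
qed

end
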